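(* Let $d\ge1$, let $1\le q<\infty$, and let $w$ be a discrete $A_q$-weight on $\mathbb{Z}^d$. Then $\mathcal{B}(\mathbb{Z}^d,\mathbb{Z}^d)$ is an inverse-closed subalgebra of $\mathcal{B}(\ell^q_w)$.
   Context: For $x=(x_1,\dots,x_d)\in\mathbb{R}^d$ put $|x|_\infty=\max(|x_1|,\dots,|x_d|)$. $\mathcal{B}(\mathbb{Z}^d,\mathbb{Z}^d)$ is the set of all complex infinite matrices $A=(a(i,j))_{i,j\in\mathbb{Z}^d}$ with $$\|A\|_{\mathcal{B}}:=\sum_{k\in\mathbb{Z}^d}\Big(\sup_{|i-j|_\infty\ge|k|_\infty}|a(i,j)|\Big)<\infty .$$ A positive sequence $w=(w(i))_{i\in\mathbb{Z}^d}$ is a discrete $A_q$-weight, for $1<q<\infty$, if there is a constant $C$ with $$\Big(N^{-d}\sum_{i\in a+[0,N-1]^d}w(i)\Big)\Big(N^{-d}\sum_{i\in a+[0,N-1]^d}w(i)^{-1/(q-1)}\Big)^{q-1}\le C$$ for all $a\in\mathbb{Z}^d$ and all integers $N\ge1$; it is a discrete $A_1$-weight if there is a constant $C$ with $N^{-d}\sum_{i\in a+[0,N-1]^d}w(i)\le C\inf_{i\in a+[0,N-1]^d}w(i)$ for all such $a,N$ (sums and infima over integer points). $\ell^q_w$ is the space of sequences $c=(c(i))_{i\in\mathbb{Z}^d}$ with $\|c\|_{q,w}:=(\sum_i|c(i)|^qw(i))^{1/q}<\infty$, and $\mathcal{B}(\ell^q_w)$ is the algebra of bounded linear operators on it. A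 matrix $A$ acts by $(Ac)(i)=\sum_{j}a(i,j)c(j)$ and is identified with the corresponding operator. A subalgebra $\mathcal{A}$ of a Banach algebra $\mathcal{D}$ is inverse-closed if, whenever $A\in\mathcal{A}$ has an inverse $A^{-1}$ in $\mathcal{D}$, then $A^{-1}\in\mathcal{A}$. *)

theory Defs
  imports "HOL-Analysis.Analysis" "HOL-Algebra.Module" "HOL-Algebra.Subrings"
begin

section \<open>The matrix class\<close>

definition max_abs :: "int ^ 'd::finite \<Rightarrow> int"
  where "max_abs x = Max (range (\<lambda>l. \<bar>x $ l\<bar>))"

text \<open>Valued in the extended nonnegative reals, so that infinite suprema and divergent
  series really are \<open>\<infinity>\<close>.\<close>

definition B_norm :: "(int ^ 'd::finite \<Rightarrow> int ^ 'd \<Rightarrow> complex) \<Rightarrow> ennreal"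
  where "B_norm a =
    (\<Sum>\<^sub>\<infinity>k\<in>(UNIV :: (int ^ 'd) set).
      SUP (i, j)\<in>{(i, j). max_abs (i - j) \<ge> max_abs k}. ennreal (cmod (a i j)))"

definition B_matrices :: "(int ^ 'd::finite \<Rightarrow> int ^ 'd \<Rightarrow> complex) set"
  where "B_matrices = {a. B_norm a < \<infinity>}"

section \<open>Discrete Muckenhoupt weights\<close>

definition cube :: "int ^ 'd::finite \<Rightarrow> nat \<Rightarrow> (int ^ 'd) set"
  where "cube a N = {i. \<forall>l. a $ l \<le> i $ l \<and> i $ l \<le> a $ l + (int N - 1)}"

definition cube_mean :: "(int ^ 'd::finite \<Rightarrow> real) \<Rightarrow> int ^ 'd \<Rightarrow> nat \<Rightarrow> real"
  where "cube_mean w a N = (\<Sum>i\<in>cube a N. w i) / real N ^ CARD('d)"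

definition discrete_A1_weight :: "(int ^ 'd::finite \<Rightarrow> real) \<Rightarrow> bool"
  where "discrete_A1_weight w \<longleftrightarrow> (\<forall>i. w i > 0) \<and>
    (\<exists>C. \<forall>a. \<forall>N\<ge>1. cube_mean w a N \<le> C * (INF i\<in>cube a N. w i))"

text \<open>For \<open>q = 1\<close> the defining condition is the separate one above; for \<open>q < 1\<close> no
  sequence is a weight.\<close>

definition discrete_Aq_weight :: "real \<Rightarrow> (int ^ 'd::finite \<Rightarrow> real) \<Rightarrow> bool"
  where "discrete_Aq_weight q w \<longleftrightarrow>
    (q = 1 \<and> discrete_A1_weight w) \<or>
    (q > 1 \<and> (\<forall>i. w i > 0) \<and>
      (\<exists>C. \<forall>a. \<forall>N\<ge>1.
        cube_mean w a N * cube_mean (\<lambda>i. w i powr (- 1 / (q - 1))) a N powr (q - 1) \<le> C))"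

section \<open>Weighted sequence spaces and their bounded operators\<close>

definition lqw :: "real \<Rightarrow> ('i \<Rightarrow> real) \<Rightarrow> ('i \<Rightarrow> complex) set"
  where "lqw q w = {c. (\<lambda>i. cmod (c i) powr q * w i) summable_on UNIV}"

definition lqw_norm :: "real \<Rightarrow> ('i \<Rightarrow> real) \<Rightarrow> ('i \<Rightarrow> complex) \<Rightarrow> real"
  where "lqw_norm q w c = (\<Sum>\<^sub>\<infinity>i\<in>UNIV. cmod (c i) powr q * w i) powr (1 / q)"

text \<open>An operator is a function that is \<open>undefined\<close> off \<^term>\<open>lqw q w\<close>, so that
  equality of operators is equality of HOL functions.\<close>

definition bounded_linear_on_lqw ::
    "real \<Rightarrow> ('i \<Rightarrow> real) \<Rightarrow> (('i \<Rightarrow> complex) \<Rightarrow> ('i \<Rightarrow> complex)) set"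
  where "bounded_linear_on_lqw q w = {T \<in> lqw q w \<rightarrow>\<^sub>E lqw q w.
    (\<forall>c\<in>lqw q w. \<forall>e\<in>lqw q w. T (\<lambda>i. c i + e i) = (\<lambda>i. T c i + T e i)) \<and>
    (\<forall>z. \<forall>c\<in>lqw q w. T (\<lambda>i. z * c i) = (\<lambda>i. z * T c i)) \<and>
    (\<exists>K. \<forall>c\<in>lqw q w. lqw_norm q w (T c) \<le> K * lqw_norm q w c)}"

definition lqw_operators ::
    "real \<Rightarrow> ('i \<Rightarrow> real) \<Rightarrow> (complex, ('i \<Rightarrow> complex) \<Rightarrow> ('i \<Rightarrow> complex)) module"
  where "lqw_operators q w = \<lparr>
    carrier = bounded_linear_on_lqw q w,
    mult = (\<lambda>S T. \<lambda>c\<in>lqw q w. S (T c)),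
    one = (\<lambda>c\<in>lqw q w. c),
    zero = (\<lambda>c\<in>lqw q w. \<lambda>i. 0),
    add = (\<lambda>S T. \<lambda>c\<in>lqw q w. \<lambda>i. S c i + T c i),
    smult = (\<lambda>z T. \<lambda>c\<in>lqw q w. \<lambda>i. z * T c i)\<rparr>"

section \<open>Matrices as operators\<close>

text \<open>\<^const>\<open>infsum\<close> is \<open>0\<close> for a family that is not summable, so convergence of these
  series has to be asserted separately.\<close>

definition mat_apply :: "('i \<Rightarrow> 'i \<Rightarrow> complex) \<Rightarrow> ('i \<Rightarrow> complex) \<Rightarrow> ('i \<Rightarrow> complex)"
  where "mat_apply a c = (\<lambda>i. \<Sum>\<^sub>\<infinity>j\<in>UNIV. a i j * c j)"

definition mat_operator ::
    "real \<Rightarrow> ('i \<Rightarrow> real) \<Rightarrow> ('i \<Rightarrow> 'i \<Rightarrow> complex) \<Rightarrow> ('i \<Rightarrow> complex) \<Rightarrow> ('i \<Rightarrow> complex)"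
  where "mat_operator q w a = (\<lambda>c\<in>lqw q w. mat_apply a c)"

section \<open>Inverse-closed subalgebras\<close>

text \<open>Subalgebras share the unit of the ambient algebra.\<close>

definition unital_subalgebra :: "'b set \<Rightarrow> ('k, 'b, 'm) module_scheme \<Rightarrow> bool"
  where "unital_subalgebra H D \<longleftrightarrow> subring H D \<and> (\<forall>z. \<forall>x\<in>H. z \<odot>\<^bsub>D\<^esub> x \<in> H)"

definition inverse_closed_subalgebra :: "'b set \<Rightarrow> ('k, 'b, 'm) module_scheme \<Rightarrow> bool"
  where "inverse_closed_subalgebra H D \<longleftrightarrow>
    unital_subalgebra H D \<and> (\<forall>x\<in>H. x \<in> Units D \<longrightarrow> inv\<^bsub>D\<^esub> x \<in> H)"

end

theory Submission
  imports Defs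
begin

text \<open>Let \<open>A\<close> be dominated by a decreasing profile \<open>h(|i - j|\<^sub>\<infinity>)\<close> with \<open>\<Sum>\<^sub>k h(|k|\<^sub>\<infinity>) < \<infinity>\<close>.
  Such a profile is a superposition of normalised indicators of balls, and averaging over balls of any
  one radius is bounded on \<open>\<ell>\<^sup>q\<^sub>w\<close> directly by the \<open>A\<^sub>q\<close> condition and doubling, so \<open>A\<close> is bounded with no
  appeal to the maximal theorem.

  Suppose \<open>A\<close> has a bounded inverse and \<open>A c = \<delta>\<^sub>m\<close>. Cut \<open>c\<close> off near \<open>x\<close> at scale \<open>N\<close> by \<open>\<psi>\<^sub>x\<close>. Then
  \<open>\<parallel>\<psi>\<^sub>x c\<parallel> \<le> K \<parallel>\<psi>\<^sub>x A c\<parallel> + K \<parallel>[A, \<psi>\<^sub>x] c\<parallel>\<close>, and for large \<open>N\<close> the commutator is small. With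
  \<open>\<alpha>(x)\<close> the \<open>w\<close>-average of \<open>|c|\<^sup>q\<close> over the \<open>N\<close>-ball at \<open>x\<close>, to the power \<open>1/q\<close>, this becomes
  \<open>\<alpha> \<le> \<beta> + v * \<alpha>\<close>, where \<open>v\<close> is a profile of small mass and \<open>\<beta>\<close> is supported near \<open>m\<close>. Solving it
  bounds \<open>\<alpha>\<close>, hence column \<open>m\<close> of the inverse, by a profile in \<open>|i - m|\<^sub>\<infinity>\<close> that does not depend on \<open>m\<close>.\<close>

section \<open>Balls in the integer lattice\<close>

text \<open>A \<open>nat\<close>-valued copy of \<open>max_abs\<close>: radial functions on the
  lattice become sequences indexed by \<open>nat\<close>, and dilations can be expressed with
  \<open>div\<close>.\<close>

definition sup_norm :: "int ^ 'd::finite \<Rightarrow> nat"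
  where "sup_norm x = nat (max_abs x)"

definition lball :: "int ^ 'd::finite \<Rightarrow> nat \<Rightarrow> (int ^ 'd) set"
  where "lball x r = {y. sup_norm (y - x) \<le> r}"

lemma max_abs_le_iff: "max_abs (x::int ^ 'd::finite) \<le> n \<longleftrightarrow> (\<forall>l. \<bar>x $ l\<bar> \<le> n)"
  unfolding max_abs_def by (subst Max_le_iff) auto

lemma max_abs_nonneg: "0 \<le> max_abs (x::int ^ 'd::finite)"
  by (meson abs_ge_zero max_abs_le_iff order.refl order.trans)

lemma int_sup_norm [simp]: "int (sup_norm (x::int ^ 'd::finite)) = max_abs x"
  by (simp add: sup_norm_def max_abs_nonneg)

lemma sup_norm_le_iff: "sup_norm (x::int ^ 'd::finite) \<le> n \<longleftrightarrow> (\<forall>l. \<bar>x $ l\<bar> \<le> int n)"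
  by (metis int_sup_norm max_abs_le_iff of_nat_le_iff)

lemma abs_component_le_sup_norm: "\<bar>x $ l\<bar> \<le> int (sup_norm (x::int ^ 'd::finite))"
  using sup_norm_le_iff by blast

lemma sup_norm_0 [simp]: "sup_norm (0::int ^ 'd::finite) = 0"
  by (metis abs_zero le_zero_eq of_nat_0_le_iff sup_norm_le_iff zero_index)

lemma sup_norm_minus_commute: "sup_norm (x - y) = sup_norm (y - x::int ^ 'd::finite)"
  by (simp add: sup_norm_def max_abs_def abs_minus_commute)

lemma sup_norm_triangle: "sup_norm (x + y) \<le> sup_norm x + sup_norm (y::int ^ 'd::finite)"
  unfolding sup_norm_le_iff
proof
  fix l
  show "\<bar>(x + y) $ l\<bar> \<le> int (sup_norm x + sup_norm y)"
    using abs_component_le_sup_norm[of x l] abs_component_le_sup_norm[of y l]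
      abs_triangle_ineq[of "x $ l" "y $ l"] by simp
qed

lemma sup_norm_triangle_diff: "sup_norm (x - z) \<le> sup_norm (x - y) + sup_norm (y - z::int ^ 'd::finite)"
  using sup_norm_triangle[of "x - y" "y - z"] by simp

lemma sup_norm_vec [simp]: "sup_norm (vec (int n) :: int ^ 'd::finite) = n"
  by (rule antisym) (simp add: sup_norm_le_iff, metis abs_component_le_sup_norm abs_of_nat of_nat_le_iff vec_component)

lemma finite_cube: "finite (cube a N)"
  and card_cube: "card (cube (a::int ^ 'd::finite) N) = N ^ CARD('d)"
proof -
  let ?P = "PiE (UNIV::'d set) (\<lambda>l. {a $ l .. a $ l + (int N - 1)})"
  have bij: "bij_betw vec_lambda ?P (cube a N)"
    by (rule bij_betwI[where g = vec_nth]) (auto simp: cube_def PiE_def Pi_def)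
  have fin: "finite ?P"
    by (intro finite_PiE) auto
  have "card ?P = N ^ CARD('d)"
    by (simp add: card_PiE)
  with bij fin show "finite (cube a N)" "card (cube a N) = N ^ CARD('d)"
    by (auto dest: bij_betw_same_card bij_betw_finite)
qed

text \<open>The bridge by which the weight condition, stated for cubes, reaches balls. The weighted
  estimates below use it for cubes of odd side only.\<close>

lemma lball_eq_cube: "lball x r = cube (x - vec (int r)) (2 * r + 1)"
  by (auto simp: lball_def cube_def sup_norm_le_iff abs_le_iff algebra_simps)

lemma finite_lball [simp]: "finite (lball x r)"
  by (simp add: lball_eq_cube finite_cube)

lemma card_lball: "card (lball (x::int ^ 'd::finite) r) = (2 * r + 1) ^ CARD('d)"
  by (simp add: lball_eq_cube card_cube)

lemma lball_sym: "y \<in> lball x r \<longleftrightarrow> x \<in> lball y r"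
  by (simp add: lball_def sup_norm_minus_commute)

lemma center_in_lball [simp]: "x \<in> lball x r"
  by (simp add: lball_def)

lemma lball_subset: "sup_norm (y - x) + r \<le> s \<Longrightarrow> lball y r \<subseteq> lball x s"
proof
  fix z assume "sup_norm (y - x) + r \<le> s" "z \<in> lball y r"
  then show "z \<in> lball x s"
    using sup_norm_triangle_diff[of z x y] by (simp add: lball_def)
qed

section \<open>Radially decreasing summable profiles\<close>

text \<open>The type argument carries the dimension: summability over the lattice depends on it, and
  the type of \<open>h\<close> does not show it.\<close>

definition profile :: "'d::finite itself \<Rightarrow> (nat \<Rightarrow> real) \<Rightarrow> bool"
  where "profile _ h \<longleftrightarrow> (\<forall>n. 0 \<le> h n) \<and> antimono h \<and>
    (\<lambda>k::int ^ 'd. h (sup_norm k)) summable_on UNIV"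

definition mass :: "'d::finite itself \<Rightarrow> (nat \<Rightarrow> real) \<Rightarrow> real"
  where "mass _ h = (\<Sum>\<^sub>\<infinity>k\<in>(UNIV::(int ^ 'd) set). h (sup_norm k))"

lemma profile_nonneg: "profile T h \<Longrightarrow> 0 \<le> h n"
  and profile_antimono: "profile T h \<Longrightarrow> m \<le> n \<Longrightarrow> h n \<le> h m"
  by (auto simp: profile_def antimono_def)

lemma mass_nonneg: "profile T h \<Longrightarrow> 0 \<le> mass T h"
  by (simp add: profile_def mass_def infsum_nonneg)

lemma
  fixes h :: "nat \<Rightarrow> real"
  assumes "\<And>n. 0 \<le> h n" "antimono h"
    and bound: "\<And>F. finite F \<Longrightarrow> (\<Sum>k\<in>F. h (sup_norm (k::int ^ 'd::finite))) \<le> M"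
  shows profileI: "profile TYPE('d) h" and mass_le: "mass TYPE('d) h \<le> M"
proof -
  have s: "(\<lambda>k::int ^ 'd. h (sup_norm k)) summable_on UNIV"
    using assms by (intro nonneg_bdd_above_summable_on) (auto simp: bdd_above_def)
  then show "profile TYPE('d) h"
    using assms by (simp add: profile_def)
  show "mass TYPE('d) h \<le> M"
    unfolding mass_def using s bound by (intro infsum_le_finite_sums) auto
qed

lemma sum_le_mass:
  fixes \<phi> :: "'a \<Rightarrow> int ^ 'd::finite"
  assumes "profile TYPE('d) h" "finite F" "inj_on \<phi> F"
  shows "(\<Sum>x\<in>F. h (sup_norm (\<phi> x))) \<le> mass TYPE('d) h"
proof -
  have "(\<Sum>x\<in>F. h (sup_norm (\<phi> x))) = (\<Sum>k\<in>\<phi> ` F. h (sup_norm k))"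
    using assms by (simp add: sum.reindex)
  also have "\<dots> \<le> mass TYPE('d) h"
    unfolding mass_def using assms by (intro finite_sum_le_infsum) (auto simp: profile_def)
  finally show ?thesis .
qed

lemma sum_le_mass_diff:
  fixes z :: "int ^ 'd::finite"
  assumes "profile TYPE('d) h" "finite F"
  shows "(\<Sum>x\<in>F. h (sup_norm (z - x))) \<le> mass TYPE('d) h"
    and "(\<Sum>x\<in>F. h (sup_norm (x - z))) \<le> mass TYPE('d) h"
  using assms by (auto intro!: sum_le_mass inj_onI)

lemma profile_add: "profile T g \<Longrightarrow> profile T h \<Longrightarrow> profile T (\<lambda>n. g n + h n)"
  and mass_add: "profile T g \<Longrightarrow> profile T h \<Longrightarrow> mass T (\<lambda>n. g n + h n) = mass T g + mass T h"
  by (auto simp: profile_def mass_def antimono_def intro!: summable_on_add infsum_add add_mono)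

lemma profile_cmult: "profile T h \<Longrightarrow> 0 \<le> c \<Longrightarrow> profile T (\<lambda>n. c * h n)"
  and mass_cmult: "mass T (\<lambda>n. c * h n) = c * mass T h"
  by (auto simp: profile_def mass_def antimono_def infsum_cmult_right' intro!: summable_on_cmult_right mult_left_mono)

lemma
  shows profile_indicator: "profile TYPE('d::finite) (\<lambda>n. if n \<le> R then 1 else 0)"
    and mass_indicator: "mass TYPE('d) (\<lambda>n. if n \<le> R then 1 else 0) \<le> (2 * real R + 1) ^ CARD('d)"
proof -
  have "(\<Sum>k\<in>F. if sup_norm k \<le> R then 1 else 0) \<le> (2 * real R + 1) ^ CARD('d)"
    if "finite F" for F :: "(int ^ 'd) set"
  proof -
    have "(\<Sum>k\<in>F. if sup_norm k \<le> R then 1 else 0) = real (card (F \<inter> lball 0 R))"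
      using that by (simp add: sum.If_cases lball_def Int_def)
    also have "\<dots> \<le> real (card (lball (0::int ^ 'd) R))"
      by (intro of_nat_mono card_mono) auto
    finally show ?thesis
      by (simp add: card_lball add.commute)
  qed
  then show "profile TYPE('d) (\<lambda>n. if n \<le> R then 1 else 0)"
    "mass TYPE('d) (\<lambda>n. if n \<le> R then 1 else 0) \<le> (2 * real R + 1) ^ CARD('d)"
    by (auto intro!: profileI mass_le simp: antimono_def)
qed

text \<open>Each k is twice \<open>\<phi> k\<close> plus a remainder with entries in {-1, 0, 1}, and
  the norm of \<open>\<phi> k\<close> is at most half that of k. Hence at most 3^d points share one
  value of \<open>\<phi>\<close>.\<close>

lemma
  assumes h: "profile TYPE('d::finite) h"
  shows profile_half: "profile TYPE('d) (\<lambda>n. h (n div 2))"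
    and mass_half: "mass TYPE('d) (\<lambda>n. h (n div 2)) \<le> 3 ^ CARD('d) * mass TYPE('d) h"
proof -
  \<comment> \<open>Taking \<open>div\<close> of the absolute value rounds toward zero. Rounding
    down would send -1 to -1 and break the norm bound \<open>le\<close>.\<close>
  define \<phi> :: "int ^ 'd \<Rightarrow> int ^ 'd" where "\<phi> k = (\<chi> l. sgn (k $ l) * (\<bar>k $ l\<bar> div 2))" for k
  define \<psi> :: "int ^ 'd \<Rightarrow> (int ^ 'd) \<times> (int ^ 'd)" where "\<psi> k = (\<phi> k, k - \<phi> k - \<phi> k)" for k
  have inj: "inj \<psi>"
    by (auto simp: inj_def \<psi>_def)
  have le: "sup_norm (\<phi> k) \<le> sup_norm k div 2" for k
  proof -
    have "\<bar>\<phi> k $ l\<bar> \<le> int (sup_norm k div 2)" for l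
      using abs_component_le_sup_norm[of k l]
      by (auto simp: \<phi>_def abs_mult sgn_if zdiv_int intro!: zdiv_mono1 simp del: int_sup_norm)
    then show ?thesis
      by (simp add: sup_norm_le_iff)
  qed
  have rem: "k - \<phi> k - \<phi> k \<in> lball 0 1" for k :: "int ^ 'd"
    by (auto simp: lball_def sup_norm_le_iff \<phi>_def sgn_if)
  have "(\<Sum>k\<in>F. h (sup_norm k div 2)) \<le> 3 ^ CARD('d) * mass TYPE('d) h"
    if F: "finite F" for F :: "(int ^ 'd) set"
  proof -
    have "(\<Sum>k\<in>F. h (sup_norm k div 2)) \<le> (\<Sum>k\<in>F. h (sup_norm (fst (\<psi> k))))"
      using le by (intro sum_mono profile_antimono[OF h]) (auto simp: \<psi>_def)
    also have "\<dots> = (\<Sum>p\<in>\<psi> ` F. h (sup_norm (fst p)))"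
      using inj by (subst sum.reindex) (auto intro: inj_on_subset)
    also have "\<dots> \<le> (\<Sum>p\<in>\<phi> ` F \<times> lball (0::int ^ 'd) 1. h (sup_norm (fst p)))"
      using F rem by (intro sum_mono2) (auto simp: \<psi>_def profile_nonneg[OF h])
    also have "\<dots> = 3 ^ CARD('d) * (\<Sum>m\<in>\<phi> ` F. h (sup_norm (id m)))"
      by (subst sum.cartesian_product') (simp add: card_lball sum_distrib_left)
    also have "\<dots> \<le> 3 ^ CARD('d) * mass TYPE('d) h"
      using F by (intro mult_left_mono sum_le_mass[OF h]) auto
    finally show ?thesis .
  qed
  moreover have "antimono (\<lambda>n. h (n div 2))"
    by (auto simp: antimono_def intro!: profile_antimono[OF h] div_le_mono)
  ultimately show "profile TYPE('d) (\<lambda>n. h (n div 2))"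
    "mass TYPE('d) (\<lambda>n. h (n div 2)) \<le> 3 ^ CARD('d) * mass TYPE('d) h"
    by (auto intro!: profileI mass_le profile_nonneg[OF h])
qed

text \<open>Markov's inequality along the diagonal: the points \<open>vec n\<close> with n < R have
  norm n, so monotonicity gives R * h R <= mass of h.\<close>

lemma profile_eventually_small:
  assumes h: "profile TYPE('d::finite) h" and "0 < \<delta>"
  obtains R where "h R \<le> \<delta>"
proof -
  obtain R :: nat where R: "mass TYPE('d) h / \<delta> < real R"
    using reals_Archimedean2 by blast
  have "real R * h R \<le> (\<Sum>n<R. h n)"
    using sum_bounded_below[of "{..<R}" "h R" h] profile_antimono[OF h] by auto
  also have "\<dots> = (\<Sum>n<R. h (sup_norm (vec (int n) :: int ^ 'd)))"
    by simp
  also have "\<dots> \<le> mass TYPE('d) h"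
    by (intro sum_le_mass[OF h]) (auto intro!: inj_onI simp: vec_eq_iff)
  also have "\<dots> < real R * \<delta>"
    using R \<open>0 < \<delta>\<close> by (simp add: field_simps)
  finally have "h R \<le> \<delta>"
    by (simp add: mult_less_cancel_left)
  then show ?thesis ..
qed

lemma profile_max:
  assumes h: "profile TYPE('d::finite) h"
  shows "profile TYPE('d) (\<lambda>n. h (max n R))"
  by (rule profileI[where M = "mass TYPE('d) h"])
     (auto simp: antimono_def intro!: profile_nonneg[OF h] profile_antimono[OF h]
       order.trans[OF sum_mono sum_le_mass[OF h, of _ id]])

lemma mass_mono:
  assumes "profile T g" "profile T h" "\<And>n. g n \<le> h n"
  shows "mass T g \<le> mass T h"
  using assms by (auto simp: profile_def mass_def intro!: infsum_mono)

text \<open>Flattening h up to r, instead of cutting it to zero there, keeps it decreasing. A finite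
  set F carries all but half of \<epsilon> of the mass, and on F the flattened function costs at
  most card F * h R.\<close>

lemma profile_tail:
  assumes h: "profile TYPE('d::finite) h" and "0 < \<epsilon>"
  obtains R where "\<And>r. R \<le> r \<Longrightarrow> mass TYPE('d) (\<lambda>n. h (max n r)) \<le> \<epsilon>"
proof -
  have "(\<lambda>k::int ^ 'd. h (sup_norm k)) summable_on UNIV"
    using h by (simp add: profile_def)
  then obtain F :: "(int ^ 'd) set" where F: "finite F"
    "dist (\<Sum>k\<in>F. h (sup_norm k)) (mass TYPE('d) h) \<le> \<epsilon> / 2"
    unfolding mass_def using infsum_finite_approximation[of _ UNIV "\<epsilon> / 2"] \<open>0 < \<epsilon>\<close> by auto
  obtain R where R: "h R \<le> \<epsilon> / (2 * (real (card F) + 1))"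
    using profile_eventually_small[OF h, of "\<epsilon> / (2 * (real (card F) + 1))"] \<open>0 < \<epsilon>\<close> by auto
  have "real (card F) * h R \<le> real (card F) * (\<epsilon> / (2 * (real (card F) + 1)))"
    by (intro mult_left_mono R) auto
  also have "\<dots> \<le> \<epsilon> / 2"
    using \<open>0 < \<epsilon>\<close> by (simp add: field_simps)
  finally have hR: "real (card F) * h R \<le> \<epsilon> / 2" .
  have "(\<Sum>k\<in>G. h (max (sup_norm k) R)) \<le> \<epsilon>" if G: "finite G" for G :: "(int ^ 'd) set"
  proof -
    have "(\<Sum>k\<in>G. h (max (sup_norm k) R)) = (\<Sum>k\<in>G \<inter> F. h (max (sup_norm k) R)) + (\<Sum>k\<in>G - F. h (max (sup_norm k) R))"
      using G by (simp add: sum.Int_Diff)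
    also have "\<dots> \<le> (\<Sum>k\<in>G \<inter> F. h R) + (\<Sum>k\<in>G - F. h (sup_norm k))"
      by (intro add_mono sum_mono profile_antimono[OF h]) auto
    also have "(\<Sum>k\<in>G \<inter> F. h R) \<le> (\<Sum>k\<in>F. h R)"
      using F by (intro sum_mono2) (auto simp: profile_nonneg[OF h])
    also have "(\<Sum>k\<in>G - F. h (sup_norm k)) = (\<Sum>k\<in>G \<union> F. h (sup_norm (id k))) - (\<Sum>k\<in>F. h (sup_norm k))"
      using F G sum_diff[of "G \<union> F" F] by (simp add: Un_Diff)
    also have "\<dots> \<le> mass TYPE('d) h - (\<Sum>k\<in>F. h (sup_norm k))"
      using F G by (intro diff_right_mono sum_le_mass[OF h]) auto
    also have "\<dots> \<le> \<epsilon> / 2"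
      using F(2)[unfolded dist_real_def, THEN abs_le_D2] by simp
    finally show ?thesis
      using hR by simp
  qed
  then have *: "mass TYPE('d) (\<lambda>n. h (max n R)) \<le> \<epsilon>"
    by (intro mass_le) (auto simp: antimono_def intro!: profile_nonneg[OF h] profile_antimono[OF h])
  show ?thesis
  proof (rule that)
    fix r assume "R \<le> r"
    then have "mass TYPE('d) (\<lambda>n. h (max n r)) \<le> mass TYPE('d) (\<lambda>n. h (max n R))"
      by (intro mass_mono profile_max[OF h] profile_antimono[OF h]) auto
    with * show "mass TYPE('d) (\<lambda>n. h (max n r)) \<le> \<epsilon>"
      by simp
  qed
qed

section \<open>Dyadic dilations and convolution of profiles\<close>

lemma
  assumes h: "profile TYPE('d::finite) h"
  shows profile_dyadic: "profile TYPE('d) (\<lambda>n. h (n div 2 ^ k))"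
    and mass_dyadic: "mass TYPE('d) (\<lambda>n. h (n div 2 ^ k)) \<le> (3 ^ CARD('d)) ^ k * mass TYPE('d) h"
proof (induction k)
  case (Suc k)
  have eq: "(\<lambda>n. h (n div 2 ^ Suc k)) = (\<lambda>n. (\<lambda>m. h (m div 2 ^ k)) (n div 2))"
    by (simp add: div_mult2_eq)
  case 1 show ?case
    unfolding eq by (rule profile_half[OF Suc(1)])
  case 2 show ?case
    unfolding eq using mult_left_mono[OF Suc(2), of "3 ^ CARD('d)"]
    by (intro order.trans[OF mass_half[OF Suc(1)]]) (simp add: mult.assoc)
qed (use h in auto)

text \<open>Replacing \<open>v\<close> by its envelope \<open>n \<mapsto> \<Sum>k. t\<^sup>k v(n div 2\<^sup>k)\<close> gains the doubling
  property \<open>u(n div 2) \<le> u n / t\<close>, which makes \<open>u\<close> stable under convolution.\<close>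

lemma doubling_envelope:
  fixes v :: "nat \<Rightarrow> real"
  defines "t \<equiv> 1 / (2 * 3 ^ CARD('d::finite))"
  assumes v: "profile TYPE('d) v"
  obtains u where "profile TYPE('d) u" "\<And>n. v n \<le> u n" "\<And>n. u (n div 2) \<le> u n / t"
    "mass TYPE('d) u \<le> 2 * mass TYPE('d) v"
proof
  define u where "u n = (\<Sum>k. t ^ k * v (n div 2 ^ k))" for n
  have t: "0 < t" "t < 1"
  proof -
    have "(1::real) \<le> 3 ^ CARD('d)"
      by simp
    then have "(1::real) < 2 * 3 ^ CARD('d)"
      by linarith
    then show "0 < t" "t < 1"
      by (simp_all add: t_def)
  qed
  have summable: "summable (\<lambda>k. t ^ k * v (n div 2 ^ k))" for n
  proof (rule summable_comparison_test')
    show "summable (\<lambda>k. t ^ k * v 0)"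
      using t by (intro summable_mult2 summable_geometric) auto
    show "norm (t ^ k * v (n div 2 ^ k)) \<le> t ^ k * v 0" for k
      using t profile_nonneg[OF v] profile_antimono[OF v] by (auto simp: abs_mult)
  qed
  have nn: "0 \<le> t ^ k * v n" for k n
    using t profile_nonneg[OF v] by simp
  show "v n \<le> u n" for n
    using sum_le_suminf[OF summable[of n], of "{0}"] nn by (simp add: u_def)
  show "u (n div 2) \<le> u n / t" for n
  proof -
    \<comment> \<open>Multiplying by t and halving n shifts the index by one, so this is the series
      of \<open>u n\<close> without its first term.\<close>
    have "t * u (n div 2) = (\<Sum>k. t ^ Suc k * v (n div 2 ^ Suc k))"
      unfolding u_def using suminf_mult[OF summable[of "n div 2"], of t]
      by (simp add: div_mult2_eq mult.assoc)
    also have "\<dots> \<le> u n"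
      using suminf_split_head[OF summable[of n]] profile_nonneg[OF v, of n] by (simp add: u_def)
    finally show ?thesis
      using t by (simp add: field_simps)
  qed
  have "0 \<le> u n" for n
    unfolding u_def by (intro suminf_nonneg summable nn)
  moreover have "antimono u"
    unfolding u_def antimono_def using t
    by (intro allI impI suminf_le summable mult_left_mono profile_antimono[OF v] div_le_mono) auto
  moreover have "(\<Sum>x\<in>F. u (sup_norm x)) \<le> 2 * mass TYPE('d) v"
    if F: "finite F" for F :: "(int ^ 'd) set"
  proof -
    \<comment> \<open>Every dilation by two costs a factor 3^d in mass. The value of t makes t * 3^d
      equal to 1/2, so the masses form a geometric series with sum twice the mass of v.\<close>
    have le: "(\<Sum>x\<in>F. t ^ k * v (sup_norm x div 2 ^ k)) \<le> (1 / 2) ^ k * mass TYPE('d) v" for k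
    proof -
      have "(\<Sum>x\<in>F. t ^ k * v (sup_norm x div 2 ^ k)) = t ^ k * (\<Sum>x\<in>F. v (sup_norm (id x) div 2 ^ k))"
        by (simp add: sum_distrib_left)
      also have "\<dots> \<le> t ^ k * ((3 ^ CARD('d)) ^ k * mass TYPE('d) v)"
        using t F
        by (intro mult_left_mono order.trans[OF sum_le_mass[OF profile_dyadic[OF v]] mass_dyadic[OF v]]) auto
      also have "\<dots> = (t * 3 ^ CARD('d)) ^ k * mass TYPE('d) v"
        by (simp add: power_mult_distrib)
      finally show ?thesis
        by (simp add: t_def)
    qed
    have "(\<Sum>x\<in>F. u (sup_norm x)) = (\<Sum>k. \<Sum>x\<in>F. t ^ k * v (sup_norm x div 2 ^ k))"
      unfolding u_def by (intro suminf_sum[symmetric] summable)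
    also have "\<dots> \<le> (\<Sum>k. (1 / 2) ^ k * mass TYPE('d) v)"
      by (intro suminf_le le summable_sum summable summable_mult2 summable_geometric) auto
    also have "\<dots> = 2 * mass TYPE('d) v"
      by (subst suminf_mult2[symmetric]) (auto simp: suminf_geometric summable_geometric)
    finally show ?thesis .
  qed
  ultimately show "profile TYPE('d) u" "mass TYPE('d) u \<le> 2 * mass TYPE('d) v"
    by (auto intro: profileI mass_le)
qed

text \<open>At least one of the two distances is no less than half the distance n from z to y; that
  factor is at most u (n div 2) <= D * u n, and the other one sums to at most the mass. The factor 2
  is there because either may be the far one.\<close>

lemma doubling_convolution:
  fixes y z :: "int ^ 'd::finite"
  assumes u: "profile TYPE('d) u" "\<And>n. u (n div 2) \<le> D * u n" and "finite F"
  shows "(\<Sum>x\<in>F. u (sup_norm (z - x)) * u (sup_norm (x - y))) \<le> 2 * D * mass TYPE('d) u * u (sup_norm (z - y))"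
proof -
  let ?n = "sup_norm (z - y)"
  have nn: "0 \<le> u n" for n
    by (rule profile_nonneg[OF u(1)])
  have "u (sup_norm (z - x)) * u (sup_norm (x - y)) \<le> u (?n div 2) * (u (sup_norm (z - x)) + u (sup_norm (x - y)))" for x
  proof -
    have "?n div 2 \<le> sup_norm (z - x) \<or> ?n div 2 \<le> sup_norm (x - y)"
      using sup_norm_triangle_diff[of z y x] by linarith
    then have "u (sup_norm (z - x)) \<le> u (?n div 2) \<or> u (sup_norm (x - y)) \<le> u (?n div 2)"
      using profile_antimono[OF u(1)] by blast
    then show ?thesis
    proof
      assume "u (sup_norm (z - x)) \<le> u (?n div 2)"
      from mult_right_mono[OF this nn, of "sup_norm (x - y)"] show ?thesis
        by (auto simp: distrib_left intro!: add_increasing mult_nonneg_nonneg nn)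
    next
      assume "u (sup_norm (x - y)) \<le> u (?n div 2)"
      from mult_left_mono[OF this nn, of "sup_norm (z - x)"] show ?thesis
        by (auto simp: distrib_left mult.commute intro!: add_increasing2 mult_nonneg_nonneg nn)
    qed
  qed
  then have "(\<Sum>x\<in>F. u (sup_norm (z - x)) * u (sup_norm (x - y)))
      \<le> u (?n div 2) * ((\<Sum>x\<in>F. u (sup_norm (z - x))) + (\<Sum>x\<in>F. u (sup_norm (x - y))))"
    by (subst sum.distrib[symmetric], subst sum_distrib_left) (intro sum_mono)
  also have "\<dots> \<le> u (?n div 2) * (mass TYPE('d) u + mass TYPE('d) u)"
    using \<open>finite F\<close> by (intro mult_left_mono add_mono sum_le_mass_diff u(1) nn)
  also have "\<dots> \<le> (D * u ?n) * (mass TYPE('d) u + mass TYPE('d) u)"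
    by (intro mult_right_mono u) (auto simp: mass_nonneg[OF u(1)])
  finally show ?thesis
    by (simp add: algebra_simps)
qed

section \<open>The matrix class in terms of profiles\<close>

text \<open>The supremum over all entries at distance at least n is the least decreasing function
  dominating the entries, and its sum over the lattice is \<open>B_norm\<close>. From here on the
  class is used only through this criterion.\<close>

lemma B_matrices_iff:
  fixes a :: "int ^ 'd::finite \<Rightarrow> int ^ 'd \<Rightarrow> complex"
  shows "a \<in> B_matrices \<longleftrightarrow> (\<exists>h. profile TYPE('d) h \<and> (\<forall>i j. cmod (a i j) \<le> h (sup_norm (i - j))))"
proof -
  define S where "S n = (SUP (i, j)\<in>{(i, j). n \<le> sup_norm (i - j)}. ennreal (cmod (a i j)))" for n
  have B: "B_norm a = (\<Sum>\<^sub>\<infinity>k\<in>(UNIV :: (int ^ 'd) set). S (sup_norm k))"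
    unfolding B_norm_def S_def
    by (simp only: int_sup_norm[symmetric] of_nat_le_iff)
  have S_upper: "ennreal (cmod (a i j)) \<le> S (sup_norm (i - j))" for i j
    unfolding S_def by (rule SUP_upper2[of "(i, j)"]) auto
  have S_antimono: "S n \<le> S m" if "m \<le> n" for m n
    unfolding S_def using that by (intro SUP_subset_mono) auto
  show ?thesis
  proof
    assume "a \<in> B_matrices"
    then have fin: "B_norm a < \<infinity>"
      by (simp add: B_matrices_def)
    have sum_le: "(\<Sum>k\<in>F. S (sup_norm k)) \<le> B_norm a" if "finite F" for F :: "(int ^ 'd) set"
      unfolding B nonneg_infsum_complete[OF zero_le] using that by (intro SUP_upper) auto
    have S_fin: "S n < \<infinity>" for n
      using sum_le[of "{vec (int n)}"] fin by auto
    define h where "h n = enn2real (S n)" for n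
    have h_nonneg: "0 \<le> h n" for n
      by (simp add: h_def)
    have S_h: "S n = ennreal (h n)" for n
      using S_fin[of n] by (simp add: h_def less_top)
    have "(\<Sum>k\<in>F. h (sup_norm k)) \<le> enn2real (B_norm a)" if "finite F" for F :: "(int ^ 'd) set"
    proof -
      have "ennreal (\<Sum>k\<in>F. h (sup_norm k)) \<le> B_norm a"
        using sum_le[OF that] by (simp add: S_h sum_ennreal h_nonneg)
      then show ?thesis
        using enn2real_mono[of "ennreal (\<Sum>k\<in>F. h (sup_norm k))" "B_norm a"] fin
        by (simp add: h_nonneg sum_nonneg)
    qed
    moreover have "antimono h"
      using S_antimono S_fin by (auto simp: antimono_def h_def intro!: enn2real_mono)
    ultimately have "profile TYPE('d) h"
      by (intro profileI) (auto simp: h_def)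
    moreover have "cmod (a i j) \<le> h (sup_norm (i - j))" for i j
      using S_upper[of i j] by (simp add: S_h h_nonneg)
    ultimately show "\<exists>h. profile TYPE('d) h \<and> (\<forall>i j. cmod (a i j) \<le> h (sup_norm (i - j)))"
      by blast
  next
    assume "\<exists>h. profile TYPE('d) h \<and> (\<forall>i j. cmod (a i j) \<le> h (sup_norm (i - j)))"
    then obtain h where h: "profile TYPE('d) h" and le: "\<And>i j. cmod (a i j) \<le> h (sup_norm (i - j))"
      by blast
    have S_le: "S n \<le> ennreal (h n)" for n
      unfolding S_def
      by (intro SUP_least) (auto intro!: ennreal_leI order.trans[OF le] profile_antimono[OF h])
    have "B_norm a \<le> ennreal (mass TYPE('d) h)"
      unfolding B nonneg_infsum_complete[OF zero_le]
    proof (rule SUP_least)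
      fix F :: "(int ^ 'd) set" assume "F \<in> {F. finite F \<and> F \<subseteq> UNIV}"
      then have "finite F"
        by simp
      have "(\<Sum>k\<in>F. S (sup_norm k)) \<le> (\<Sum>k\<in>F. ennreal (h (sup_norm (id k))))"
        by (intro sum_mono) (simp add: S_le)
      also have "\<dots> \<le> ennreal (mass TYPE('d) h)"
        using \<open>finite F\<close> by (subst sum_ennreal) (auto intro!: ennreal_leI sum_le_mass[OF h] profile_nonneg[OF h])
      finally show "(\<Sum>k\<in>F. S (sup_norm k)) \<le> ennreal (mass TYPE('d) h)" .
    qed
    also have "\<dots> < \<infinity>"
      by simp
    finally show "a \<in> B_matrices"
      by (simp add: B_matrices_def)
  qed
qed

lemma B_matricesE:
  fixes a :: "int ^ 'd::finite \<Rightarrow> int ^ 'd \<Rightarrow> complex"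
  assumes "a \<in> B_matrices"
  obtains h where "profile TYPE('d) h" "\<And>i j. cmod (a i j) \<le> h (sup_norm (i - j))"
  using assms by (auto simp: B_matrices_iff)

section \<open>Jensen's inequality for powers\<close>

text \<open>For two positive points this is \<open>powr_convex\<close>; if one of them is 0, it
  reduces to t powr q <= t for t in (0, 1).\<close>

lemma convex_on_powr_nonneg:
  assumes "1 \<le> q"
  shows "convex_on {0..} (\<lambda>x::real. x powr q)"
proof (rule convex_onI)
  have scale: "(t * z) powr q \<le> t * z powr q" if "0 < t" "t < 1" "0 \<le> z" for t z :: real
  proof -
    have "t powr q \<le> t powr 1"
      using that assms by (intro powr_mono') auto
    then have "t powr q * z powr q \<le> t * z powr q"
      using that by (intro mult_right_mono) auto
    then show ?thesis
      using that by (simp add: powr_mult)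
  qed
  fix t x y :: real
  assume t: "0 < t" "t < 1" and xy: "x \<in> {0..}" "y \<in> {0..}"
  consider "x = 0" | "y = 0" | "0 < x" "0 < y"
    using xy by fastforce
  then show "((1 - t) *\<^sub>R x + t *\<^sub>R y) powr q \<le> (1 - t) * x powr q + t * y powr q"
  proof cases
    case 1 then show ?thesis using scale[of t y] t xy by simp
  next
    case 2 then show ?thesis using scale[of "1 - t" x] t xy by simp
  next
    case 3 then show ?thesis
      using convex_onD[OF powr_convex[OF assms], of t x y] t by simp
  qed
qed auto

text \<open>Jensen with unnormalised weights: dividing a by its sum M gives a convex combination,
  and undoing the division leaves M powr (q - 1). It serves as Hoelder's inequality without a
  conjugate exponent, hence also at q = 1.\<close>

lemma jensen_powr:
  fixes a x :: "'a \<Rightarrow> real"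
  assumes "1 \<le> q" "finite S" and a: "\<And>s. s \<in> S \<Longrightarrow> 0 \<le> a s" and x: "\<And>s. s \<in> S \<Longrightarrow> 0 \<le> x s"
  shows "(\<Sum>s\<in>S. a s * x s) powr q \<le> (\<Sum>s\<in>S. a s) powr (q - 1) * (\<Sum>s\<in>S. a s * x s powr q)"
proof (cases "(\<Sum>s\<in>S. a s) = 0")
  case True
  then have "\<And>s. s \<in> S \<Longrightarrow> a s = 0"
    using assms sum_nonneg_eq_0_iff[of S a] by auto
  then show ?thesis
    by simp
next
  case False
  define M where "M = (\<Sum>s\<in>S. a s)"
  have M: "0 < M"
    using False sum_nonneg[of S a] a by (auto simp: M_def less_le)
  have "((\<Sum>s\<in>S. (a s / M) *\<^sub>R x s)) powr q \<le> (\<Sum>s\<in>S. (a s / M) * x s powr q)"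
    using assms False M
    by (intro convex_on_sum[OF _ _ convex_on_powr_nonneg]) (auto simp: sum_divide_distrib[symmetric] M_def)
  also have "(\<Sum>s\<in>S. (a s / M) *\<^sub>R x s) = (\<Sum>s\<in>S. a s * x s) / M"
    by (simp add: sum_divide_distrib)
  also have "((\<Sum>s\<in>S. a s * x s) / M) powr q = (\<Sum>s\<in>S. a s * x s) powr q / M powr q"
    using M a x by (simp add: powr_divide sum_nonneg)
  also have "(\<Sum>s\<in>S. (a s / M) * x s powr q) = (\<Sum>s\<in>S. a s * x s powr q) / M"
    by (simp add: sum_divide_distrib)
  finally have "(\<Sum>s\<in>S. a s * x s) powr q \<le> M powr q / M * (\<Sum>s\<in>S. a s * x s powr q)"
    using M by (simp add: field_simps)
  also have "M powr q / M = M powr (q - 1)"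
    using M by (simp add: powr_diff)
  finally show ?thesis
    by (simp add: M_def)
qed

section \<open>Weighted estimates\<close>

definition vol :: "'d::finite itself \<Rightarrow> nat \<Rightarrow> real"
  where "vol _ r = (1 + 2 * real r) ^ CARD('d)"

lemma vol_pos [simp]: "0 < vol T r"
  by (simp add: vol_def)

lemma vol_neq_0 [simp]: "vol T r \<noteq> 0"
  using vol_pos[of T r] by linarith

lemma vol_mult: "2 * s + 1 \<le> m * (2 * r + 1) \<Longrightarrow> vol TYPE('d::finite) s \<le> real m ^ CARD('d) * vol TYPE('d) r"
  unfolding vol_def power_mult_distrib[symmetric]
  by (intro power_mono) (use of_nat_mono[of "2 * s + 1" "m * (2 * r + 1)", where 'a = real] in \<open>auto simp: algebra_simps\<close>)

text \<open>The inequality below (averages are controlled by weighted \<open>q\<close>-averages) is all that is used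
  of the Muckenhoupt condition; it treats \<open>q = 1\<close> and \<open>q > 1\<close> alike.\<close>

locale muckenhoupt =
  fixes q :: real and w :: "int ^ 'd::finite \<Rightarrow> real" and C :: real
  assumes q: "1 \<le> q" and w_pos: "0 < w i"
    and mean_le: "1 \<le> N \<Longrightarrow> (\<And>i. 0 \<le> f i) \<Longrightarrow>
      (\<Sum>i\<in>cube a N. f i) powr q * (\<Sum>i\<in>cube a N. w i)
        \<le> C * (real N ^ CARD('d)) powr q * (\<Sum>i\<in>cube a N. f i powr q * w i)"
begin

abbreviation ball_weight :: "int ^ 'd \<Rightarrow> nat \<Rightarrow> real"
  where "ball_weight x r \<equiv> \<Sum>i\<in>lball x r. w i"

lemma w_nonneg: "0 \<le> w i"
  using w_pos less_imp_le by blast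

lemma ball_weight_pos: "0 < ball_weight x r"
  by (intro sum_pos w_pos) (auto intro: center_in_lball)

lemma mean_le_ball:
  assumes "\<And>i. 0 \<le> f i"
  shows "(\<Sum>i\<in>lball x r. f i) powr q * ball_weight x r
    \<le> C * vol TYPE('d) r powr q * (\<Sum>i\<in>lball x r. f i powr q * w i)"
  using mean_le[of "2 * r + 1" f "x - vec (int r)"] assms
  by (simp add: lball_eq_cube vol_def)

lemma C_ge_1: "1 \<le> C"
  using mean_le_ball[of "\<lambda>_. 1" 0 0] ball_weight_pos[of 0 0] by (simp add: card_lball vol_def)

lemma C_pos: "0 < C"
  using C_ge_1 by linarith

text \<open>The doubling constant for nested balls whose side lengths have ratio at most m.\<close>

definition dbl :: "nat \<Rightarrow> real"
  where "dbl m = C * (real m ^ CARD('d)) powr q"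

lemma dbl_nonneg: "0 \<le> dbl m"
  using C_pos by (simp add: dbl_def)

text \<open>The averaging inequality on the large ball, tested on the indicator of the small
  one.\<close>

lemma ball_weight_doubling:
  assumes sub: "lball y r \<subseteq> lball x s" and "2 * s + 1 \<le> m * (2 * r + 1)"
  shows "ball_weight x s \<le> dbl m * ball_weight y r"
proof -
  define f :: "int ^ 'd \<Rightarrow> real" where "f i = (if i \<in> lball y r then 1 else 0)" for i
  have "(\<Sum>i\<in>lball x s. f i) = vol TYPE('d) r"
    using sub by (simp add: f_def sum.If_cases Int_absorb1 card_lball vol_def)
  moreover have "(\<Sum>i\<in>lball x s. f i powr q * w i) = ball_weight y r"
    using sub by (simp add: f_def if_distrib if_distribR sum.If_cases Int_absorb1 cong: if_cong)
  ultimately have "vol TYPE('d) r powr q * ball_weight x s \<le> C * vol TYPE('d) s powr q * ball_weight y r"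
    using mean_le_ball[of f x s] by (simp add: f_def)
  also have "\<dots> \<le> C * (real m ^ CARD('d) * vol TYPE('d) r) powr q * ball_weight y r"
    using C_pos ball_weight_pos[of y r] q vol_mult[OF assms(2), where 'd = 'd]
    by (intro mult_right_mono mult_left_mono powr_mono2) (auto simp: less_imp_le)
  also have "\<dots> = vol TYPE('d) r powr q * (dbl m * ball_weight y r)"
    by (simp add: powr_mult dbl_def less_imp_le mult_ac)
  finally show ?thesis
    by (rule mult_left_le_imp_le) simp
qed

text \<open>Boundedness of averaging, by exchanging the sums: for j in the ball at i, doubling
  compares the weights of the balls at i and at j, and then the weight of the points i near j is at
  most that of the ball at j.\<close>

lemma sum_local_mean_le:
  assumes F: "finite F" and G: "finite G" and g: "\<And>j. 0 \<le> g j"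
  shows "(\<Sum>i\<in>F. w i * ((\<Sum>j\<in>G \<inter> lball i r. g j) / ball_weight i r)) \<le> dbl 2 * (\<Sum>j\<in>G. g j)"
proof -
  have le: "w i * (g j / ball_weight i r) \<le> dbl 2 * (g j * (w i / ball_weight j r))" if "j \<in> lball i r" for i j
  proof -
    have "lball j r \<subseteq> lball i (2 * r)"
      using that by (intro lball_subset) (simp add: lball_def)
    then have "ball_weight j r \<le> ball_weight i (2 * r)"
      by (intro sum_mono2) (auto simp: w_nonneg)
    also have "\<dots> \<le> dbl 2 * ball_weight i r"
      by (intro ball_weight_doubling lball_subset) auto
    finally have "1 / ball_weight i r \<le> dbl 2 / ball_weight j r"
      using ball_weight_pos[of i r] ball_weight_pos[of j r] by (simp add: field_simps)
    then have "w i * g j * (1 / ball_weight i r) \<le> w i * g j * (dbl 2 / ball_weight j r)"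
      by (intro mult_left_mono) (auto simp: w_nonneg g)
    then show ?thesis
      by (simp add: mult_ac)
  qed
  have "(\<Sum>i\<in>F. w i * ((\<Sum>j\<in>G \<inter> lball i r. g j) / ball_weight i r))
      = (\<Sum>i\<in>F. \<Sum>j | j \<in> G \<and> j \<in> lball i r. w i * (g j / ball_weight i r))"
    by (simp add: sum_distrib_left sum_divide_distrib Int_def)
  also have "\<dots> \<le> (\<Sum>i\<in>F. \<Sum>j | j \<in> G \<and> j \<in> lball i r. dbl 2 * (g j * (w i / ball_weight j r)))"
    by (intro sum_mono le) auto
  also have "\<dots> = (\<Sum>j\<in>G. \<Sum>i | i \<in> F \<and> j \<in> lball i r. dbl 2 * (g j * (w i / ball_weight j r)))"
    by (rule sum.swap_restrict[OF F G])
  also have "\<dots> = (\<Sum>j\<in>G. dbl 2 * (g j * ((\<Sum>i | i \<in> F \<and> j \<in> lball i r. w i) / ball_weight j r)))"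
    by (simp add: sum_distrib_left sum_divide_distrib)
  also have "\<dots> \<le> (\<Sum>j\<in>G. dbl 2 * (g j * 1))"
  proof (intro sum_mono mult_left_mono dbl_nonneg g)
    fix j
    have "(\<Sum>i | i \<in> F \<and> j \<in> lball i r. w i) \<le> ball_weight j r"
      by (intro sum_mono2) (auto simp: w_nonneg lball_sym)
    then show "(\<Sum>i | i \<in> F \<and> j \<in> lball i r. w i) / ball_weight j r \<le> 1"
      using ball_weight_pos[of j r] by (simp add: divide_le_eq_1)
  qed
  finally show ?thesis
    by (simp add: sum_distrib_left)
qed

text \<open>Layer cake: \<open>h\<close> is a superposition of normalised indicators of balls, with total
  coefficient at most the mass of \<open>h\<close>.\<close>

lemma sum_conv_powr_le:
  assumes h: "profile TYPE('d) h" and F: "finite F" and G: "finite G" and c: "\<And>j. 0 \<le> c j"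
  shows "(\<Sum>i\<in>F. (\<Sum>j\<in>G. h (sup_norm (i - j)) * c j) powr q * w i)
    \<le> C * dbl 2 * mass TYPE('d) h powr q * (\<Sum>j\<in>G. c j powr q * w j)"
proof -
  define R where "R = Max (insert 0 ((\<lambda>(i, j). sup_norm (i - j)) ` (F \<times> G)))"
  have R: "sup_norm (i - j) \<le> R" if "i \<in> F" "j \<in> G" for i j
    unfolding R_def using that F G by (intro Max_ge) force+
  \<comment> \<open>R bounds all distances between F and G, so truncating there changes nothing and
    makes the layer sum finite; the drop of \<open>h'\<close> to 0 at R + 1 gives the last layer its
    full height h R.\<close>
  define h' where "h' n = (if n \<le> R then h n else 0)" for n
  define lam where "lam r = h' r - h' (Suc r)" for r
  have lam: "0 \<le> lam r" for r
    using profile_nonneg[OF h] profile_antimono[OF h] by (auto simp: lam_def h'_def)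
  have layer: "(\<Sum>r | r \<in> {..R} \<and> n \<le> r. lam r) = h n" if "n \<le> R" for n
  proof -
    have "{r. r \<in> {..R} \<and> n \<le> r} = {n..<Suc R}"
      by auto
    moreover have "(\<Sum>r\<in>{n..<Suc R}. lam r) = - (\<Sum>r\<in>{n..<Suc R}. h' (Suc r) - h' r)"
      by (simp add: lam_def sum_subtractf)
    ultimately show ?thesis
      using sum_Suc_diff'[of n "Suc R" h'] that by (simp add: h'_def)
  qed
  define M where "M = (\<Sum>r\<le>R. lam r * vol TYPE('d) r)"
  define m where "m r i = (\<Sum>j\<in>G \<inter> lball i r. c j) / vol TYPE('d) r" for r i
  define S where "S = (\<Sum>j\<in>G. c j powr q * w j)"
  have m: "0 \<le> m r i" for r i
    unfolding m_def by (intro divide_nonneg_pos sum_nonneg c) auto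
  have "0 \<le> S"
    unfolding S_def by (intro sum_nonneg mult_nonneg_nonneg w_nonneg) auto
  have "0 \<le> M"
    unfolding M_def by (intro sum_nonneg mult_nonneg_nonneg lam) (simp add: less_imp_le)
  \<comment> \<open>\<open>lam r * vol r\<close> sums the constant \<open>lam r\<close> over a ball.
    Exchanging the two sums stacks the layers over each point and returns a partial sum of the
    mass.\<close>
  have M_le: "M \<le> mass TYPE('d) h"
  proof -
    have "M = (\<Sum>r\<in>{..R}. \<Sum>k | k \<in> lball (0::int ^ 'd) R \<and> sup_norm k \<le> r. lam r)"
    proof -
      have "{k. k \<in> lball (0::int ^ 'd) R \<and> sup_norm k \<le> r} = lball 0 r" if "r \<le> R" for r
        using that by (auto simp: lball_def)
      then show ?thesis
        by (simp add: M_def card_lball vol_def mult.commute)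
    qed
    also have "\<dots> = (\<Sum>k\<in>lball (0::int ^ 'd) R. \<Sum>r | r \<in> {..R} \<and> sup_norm k \<le> r. lam r)"
      by (intro sum.swap_restrict) auto
    also have "\<dots> = (\<Sum>k\<in>lball (0::int ^ 'd) R. h (sup_norm (id k)))"
      by (intro sum.cong refl) (subst layer, auto simp: lball_def)
    also have "\<dots> \<le> mass TYPE('d) h"
      by (intro sum_le_mass[OF h]) auto
    finally show ?thesis .
  qed
  have pointwise: "(\<Sum>j\<in>G. h (sup_norm (i - j)) * c j) = (\<Sum>r\<le>R. lam r * vol TYPE('d) r * m r i)" if "i \<in> F" for i
  proof -
    have "(\<Sum>j\<in>G. h (sup_norm (i - j)) * c j) = (\<Sum>j\<in>G. \<Sum>r | r \<in> {..R} \<and> sup_norm (i - j) \<le> r. lam r * c j)"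
      using R[OF that] by (intro sum.cong refl) (subst layer[symmetric], auto simp: sum_distrib_right)
    also have "\<dots> = (\<Sum>r\<in>{..R}. \<Sum>j | j \<in> G \<and> sup_norm (i - j) \<le> r. lam r * c j)"
      by (intro sum.swap_restrict G) auto
    also have "\<dots> = (\<Sum>r\<in>{..R}. lam r * (\<Sum>j\<in>G \<inter> lball i r. c j))"
      by (simp add: sum_distrib_left lball_def Int_def sup_norm_minus_commute)
    finally show ?thesis
      by (simp add: m_def mult.assoc)
  qed
  \<comment> \<open>The weight condition turns an unweighted average into a weighted q-average,
    which is the form that \<open>sum_local_mean_le\<close> can sum over i.\<close>
  have mean: "m r i powr q \<le> C * ((\<Sum>j\<in>G \<inter> lball i r. c j powr q * w j) / ball_weight i r)" for r i
  proof -
    define f where "f j = (if j \<in> G then c j else 0)" for j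
    have "(\<Sum>j\<in>lball i r. f j) = (\<Sum>j\<in>G \<inter> lball i r. c j)"
      "(\<Sum>j\<in>lball i r. f j powr q * w j) = (\<Sum>j\<in>G \<inter> lball i r. c j powr q * w j)"
      by (auto simp: f_def intro!: sum.mono_neutral_cong_right split: if_splits)
    moreover have "(\<Sum>j\<in>lball i r. f j) powr q * ball_weight i r
        \<le> C * vol TYPE('d) r powr q * (\<Sum>j\<in>lball i r. f j powr q * w j)"
      by (intro mean_le_ball) (simp add: f_def c)
    ultimately show ?thesis
      using ball_weight_pos[of i r] c
      by (simp add: m_def powr_divide sum_nonneg less_imp_le field_simps)
  qed
  \<comment> \<open>Jensen over the radii, with weights \<open>lam r * vol r\<close> of total M; the
    remaining estimate is then for each radius separately.\<close>
  have "(\<Sum>i\<in>F. (\<Sum>j\<in>G. h (sup_norm (i - j)) * c j) powr q * w i)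
      \<le> (\<Sum>i\<in>F. (M powr (q - 1) * (\<Sum>r\<le>R. lam r * vol TYPE('d) r * m r i powr q)) * w i)"
    unfolding M_def by (intro sum_mono mult_right_mono w_nonneg) 
      (simp only: pointwise, intro jensen_powr q, auto simp: lam m less_imp_le)
  also have "\<dots> = M powr (q - 1) * (\<Sum>r\<le>R. lam r * vol TYPE('d) r * (\<Sum>i\<in>F. w i * m r i powr q))"
    unfolding sum_distrib_left sum_distrib_right by (subst sum.swap) (simp add: mult_ac)
  also have "\<dots> \<le> M powr (q - 1) * (\<Sum>r\<le>R. lam r * vol TYPE('d) r * (C * dbl 2 * S))"
  proof (intro mult_left_mono sum_mono)
    fix r
    have "(\<Sum>i\<in>F. w i * m r i powr q) \<le> (\<Sum>i\<in>F. w i * (C * ((\<Sum>j\<in>G \<inter> lball i r. c j powr q * w j) / ball_weight i r)))"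
      by (intro sum_mono mult_left_mono mean w_nonneg)
    also have "\<dots> = C * (\<Sum>i\<in>F. w i * ((\<Sum>j\<in>G \<inter> lball i r. c j powr q * w j) / ball_weight i r))"
      by (simp add: sum_distrib_left mult_ac)
    also have "\<dots> \<le> C * (dbl 2 * S)"
      unfolding S_def using C_pos F G by (intro mult_left_mono sum_local_mean_le) (auto simp: w_nonneg)
    finally show "(\<Sum>i\<in>F. w i * m r i powr q) \<le> C * dbl 2 * S"
      by (simp add: mult.assoc)
  qed (auto simp: lam less_imp_le)
  also have "\<dots> = (M powr (q - 1) * M) * (C * dbl 2 * S)"
    by (simp add: M_def sum_distrib_right mult.assoc)
  also have "M powr (q - 1) * M = M powr q"
    using \<open>0 \<le> M\<close> by (cases "M = 0") (auto simp: powr_diff)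
  also have "M powr q * (C * dbl 2 * S) \<le> mass TYPE('d) h powr q * (C * dbl 2 * S)"
    using M_le \<open>0 \<le> M\<close> \<open>0 \<le> S\<close> q C_pos dbl_nonneg by (intro mult_right_mono powr_mono2) auto
  finally show ?thesis
    by (simp add: S_def mult_ac)
qed

subsection \<open>The weighted norm\<close>

text \<open>Restricted to nonnegative real sequences: complex ones enter through their absolute
  values, so that estimates are transferred by pointwise domination.\<close>

definition Lq :: "(int ^ 'd \<Rightarrow> real) \<Rightarrow> bool"
  where "Lq f \<longleftrightarrow> (\<forall>i. 0 \<le> f i) \<and> (\<lambda>i. f i powr q * w i) summable_on UNIV"

definition nrm :: "(int ^ 'd \<Rightarrow> real) \<Rightarrow> real"
  where "nrm f = (\<Sum>\<^sub>\<infinity>i\<in>UNIV. f i powr q * w i) powr (1 / q)"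

lemma lqw_iff: "c \<in> lqw q w \<longleftrightarrow> Lq (\<lambda>i. cmod (c i))"
  by (simp add: lqw_def Lq_def)

lemma lqw_norm_eq: "lqw_norm q w c = nrm (\<lambda>i. cmod (c i))"
  by (simp add: lqw_norm_def nrm_def)

lemma nrm_nonneg: "0 \<le> nrm f"
  by (simp add: nrm_def)

lemma Lq_nonneg: "Lq f \<Longrightarrow> 0 \<le> f i"
  by (simp add: Lq_def)

lemma nrm_powr: "nrm f powr q = (\<Sum>\<^sub>\<infinity>i\<in>UNIV. f i powr q * w i)"
  using q infsum_nonneg[of UNIV "\<lambda>i. f i powr q * w i"] w_nonneg by (simp add: nrm_def powr_powr)

lemma sum_le_nrm_powr: "Lq f \<Longrightarrow> finite F \<Longrightarrow> (\<Sum>i\<in>F. f i powr q * w i) \<le> nrm f powr q"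
  unfolding nrm_powr by (intro finite_sum_le_infsum) (auto simp: Lq_def w_nonneg)

lemma
  assumes "\<And>i. 0 \<le> f i" "0 \<le> B" and bound: "\<And>F. finite F \<Longrightarrow> (\<Sum>i\<in>F. f i powr q * w i) \<le> B powr q"
  shows LqI: "Lq f" and nrm_le: "nrm f \<le> B"
proof -
  have s: "(\<lambda>i. f i powr q * w i) summable_on UNIV"
    using bound w_nonneg by (intro nonneg_bdd_above_summable_on) (auto simp: bdd_above_def)
  then show "Lq f"
    using assms by (simp add: Lq_def)
  have "(\<Sum>\<^sub>\<infinity>i\<in>UNIV. f i powr q * w i) \<le> B powr q"
    using s bound by (intro infsum_le_finite_sums) auto
  then have "nrm f \<le> (B powr q) powr (1 / q)"
    unfolding nrm_def using q w_nonneg by (intro powr_mono2 infsum_nonneg) auto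
  then show "nrm f \<le> B"
    using q \<open>0 \<le> B\<close> by (simp add: powr_powr)
qed

lemma
  assumes g: "Lq g" and f: "\<And>i. 0 \<le> f i" "\<And>i. f i \<le> g i"
  shows Lq_mono: "Lq f" and nrm_mono: "nrm f \<le> nrm g"
proof -
  have "(\<Sum>i\<in>F. f i powr q * w i) \<le> nrm g powr q" if "finite F" for F
    using f q w_nonneg
    by (intro order.trans[OF sum_mono sum_le_nrm_powr[OF g that]] mult_right_mono powr_mono2) auto
  then show "Lq f" "nrm f \<le> nrm g"
    by (auto intro!: LqI[of f "nrm g"] nrm_le f nrm_nonneg)
qed

text \<open>Minkowski from Jensen with the two weights a and b, applied to f / a and g / b. Strictly
  positive bounds a, b stand in for the norms, which may vanish; the slack tends to zero at the
  end.\<close>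

lemma
  assumes f: "Lq f" and g: "Lq g"
  shows Lq_add: "Lq (\<lambda>i. f i + g i)" and nrm_triangle: "nrm (\<lambda>i. f i + g i) \<le> nrm f + nrm g"
proof -
  have *: "(\<Sum>i\<in>F. (f i + g i) powr q * w i) \<le> (a + b) powr q"
    if "finite F" and a: "0 < a" "nrm f \<le> a" and b: "0 < b" "nrm g \<le> b" for F a b
  proof -
    have le1: "(\<Sum>i\<in>F. (e i / s) powr q * w i) \<le> 1" if "Lq e" "0 < s" "nrm e \<le> s" for e s
    proof -
      have "(\<Sum>i\<in>F. (e i / s) powr q * w i) = (\<Sum>i\<in>F. e i powr q * w i) / s powr q"
        using that Lq_nonneg by (simp add: powr_divide sum_divide_distrib)
      also have "\<dots> \<le> nrm e powr q / s powr q"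
        using that \<open>finite F\<close> by (intro divide_right_mono sum_le_nrm_powr) auto
      also have "\<dots> \<le> 1"
        using that q nrm_nonneg by (simp add: divide_le_eq_1 powr_mono2)
      finally show ?thesis .
    qed
    have "(f i + g i) powr q \<le> (a + b) powr (q - 1) * (a * (f i / a) powr q + b * (g i / b) powr q)" for i
      using jensen_powr[OF q, of "{True, False}" "\<lambda>s. if s then a else b" "\<lambda>s. if s then f i / a else g i / b"]
        a b Lq_nonneg[OF f, of i] Lq_nonneg[OF g, of i] by simp
    then have "(\<Sum>i\<in>F. (f i + g i) powr q * w i)
        \<le> (\<Sum>i\<in>F. ((a + b) powr (q - 1) * (a * (f i / a) powr q + b * (g i / b) powr q)) * w i)"
      by (intro sum_mono mult_right_mono w_nonneg)
    also have "\<dots> = (a + b) powr (q - 1) *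
        (a * (\<Sum>i\<in>F. (f i / a) powr q * w i) + b * (\<Sum>i\<in>F. (g i / b) powr q * w i))"
      by (simp add: sum_distrib_left distrib_left distrib_right sum.distrib mult_ac)
    also have "\<dots> \<le> (a + b) powr (q - 1) * (a * 1 + b * 1)"
      using a b f g by (intro mult_left_mono add_mono le1) auto
    also have "\<dots> = (a + b) powr q"
      using a b by (simp add: powr_diff)
    finally show ?thesis .
  qed
  have nn: "0 \<le> f i + g i" for i
    using f g by (simp add: Lq_nonneg)
  show "Lq (\<lambda>i. f i + g i)"
    using nrm_nonneg[of f] nrm_nonneg[of g] nn
    by (intro LqI[where B = "(nrm f + 1) + (nrm g + 1)"] *) (simp_all add: add_nonneg_pos)
  show "nrm (\<lambda>i. f i + g i) \<le> nrm f + nrm g"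
  proof (rule field_le_epsilon)
    fix e :: real assume "0 < e"
    have "nrm (\<lambda>i. f i + g i) \<le> (nrm f + e / 2) + (nrm g + e / 2)"
    proof (rule nrm_le[OF nn])
      fix F :: "(int ^ 'd) set" assume "finite F"
      then show "(\<Sum>i\<in>F. (f i + g i) powr q * w i) \<le> (nrm f + e / 2 + (nrm g + e / 2)) powr q"
        using nrm_nonneg[of f] nrm_nonneg[of g] \<open>0 < e\<close> by (intro *) (simp_all add: add_nonneg_pos)
    qed (use nrm_nonneg[of f] nrm_nonneg[of g] \<open>0 < e\<close> in simp)
    then show "nrm (\<lambda>i. f i + g i) \<le> nrm f + nrm g + e"
      by simp
  qed
qed

lemma
  assumes "Lq f" "0 \<le> a"
  shows Lq_cmult: "Lq (\<lambda>i. a * f i)" and nrm_cmult: "nrm (\<lambda>i. a * f i) \<le> a * nrm f"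
proof -
  have "(\<Sum>i\<in>F. (a * f i) powr q * w i) \<le> (a * nrm f) powr q" if "finite F" for F
  proof -
    have "(\<Sum>i\<in>F. (a * f i) powr q * w i) = a powr q * (\<Sum>i\<in>F. f i powr q * w i)"
      using assms Lq_nonneg by (simp add: powr_mult sum_distrib_left mult.assoc)
    also have "\<dots> \<le> a powr q * nrm f powr q"
      using assms that by (intro mult_left_mono sum_le_nrm_powr) auto
    also have "\<dots> = (a * nrm f) powr q"
      using assms nrm_nonneg by (simp add: powr_mult)
    finally show ?thesis .
  qed
  then show "Lq (\<lambda>i. a * f i)" "nrm (\<lambda>i. a * f i) \<le> a * nrm f"
    using assms nrm_nonneg Lq_nonneg by (auto intro!: LqI[of _ "a * nrm f"] nrm_le)
qed

lemma
  assumes "finite S" "\<And>i. 0 \<le> f i" "\<And>i. i \<notin> S \<Longrightarrow> f i = 0"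
  shows Lq_finite_support: "Lq f"
    and nrm_finite_support: "nrm f = (\<Sum>i\<in>S. f i powr q * w i) powr (1 / q)"
proof -
  have "((\<lambda>i. f i powr q * w i) has_sum (\<Sum>i\<in>S. f i powr q * w i)) UNIV"
    using assms by (intro has_sum_finite_neutralI[of S]) auto
  then show "Lq f" "nrm f = (\<Sum>i\<in>S. f i powr q * w i) powr (1 / q)"
    using assms by (auto simp: Lq_def nrm_def summable_on_def infsumI)
qed

lemma
  assumes "finite S" "\<And>s. s \<in> S \<Longrightarrow> Lq (f s)"
  shows Lq_sum: "Lq (\<lambda>i. \<Sum>s\<in>S. f s i)"
    and nrm_sum: "nrm (\<lambda>i. \<Sum>s\<in>S. f s i) \<le> (\<Sum>s\<in>S. nrm (f s))"
proof -
  have "Lq (\<lambda>i. \<Sum>s\<in>S. f s i) \<and> nrm (\<lambda>i. \<Sum>s\<in>S. f s i) \<le> (\<Sum>s\<in>S. nrm (f s))"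
    using assms
  proof (induction S)
    case empty
    show ?case
      by (simp add: Lq_def nrm_def)
  next
    case (insert s S)
    then show ?case
      using Lq_add[of "f s" "\<lambda>i. \<Sum>s\<in>S. f s i"] nrm_triangle[of "f s" "\<lambda>i. \<Sum>s\<in>S. f s i"] by auto
  qed
  then show "Lq (\<lambda>i. \<Sum>s\<in>S. f s i)" "nrm (\<lambda>i. \<Sum>s\<in>S. f s i) \<le> (\<Sum>s\<in>S. nrm (f s))"
    by auto
qed

definition conv :: "(nat \<Rightarrow> real) \<Rightarrow> (int ^ 'd \<Rightarrow> real) \<Rightarrow> int ^ 'd \<Rightarrow> real"
  where "conv h c i = (\<Sum>\<^sub>\<infinity>j\<in>UNIV. h (sup_norm (i - j)) * c j)"

definition opC :: real
  where "opC = (C * dbl 2) powr (1 / q)"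

lemma opC_nonneg: "0 \<le> opC"
  by (simp add: opC_def)

lemma opC_powr: "opC powr q = C * dbl 2"
  using q C_pos dbl_nonneg by (simp add: opC_def powr_powr)

text \<open>The bound for finite F and G is uniform. With F a single point it gives convergence of
  the series there; letting G exhaust the lattice with F fixed then gives the norm bound.\<close>

lemma
  assumes h: "profile TYPE('d) h" and c: "Lq c"
  shows summable_conv: "(\<lambda>j. h (sup_norm (i - j)) * c j) summable_on UNIV"
    and conv_nonneg: "0 \<le> conv h c i"
    and Lq_conv: "Lq (conv h c)"
    and nrm_conv: "nrm (conv h c) \<le> opC * mass TYPE('d) h * nrm c"
proof -
  let ?B = "opC * mass TYPE('d) h * nrm c"
  have B: "0 \<le> ?B"
    by (intro mult_nonneg_nonneg opC_nonneg mass_nonneg[OF h] nrm_nonneg)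
  have nn: "0 \<le> h (sup_norm (i - j)) * c j" for i j
    using profile_nonneg[OF h] Lq_nonneg[OF c] by simp
  have *: "(\<Sum>i\<in>F. (\<Sum>j\<in>G. h (sup_norm (i - j)) * c j) powr q * w i) \<le> ?B powr q"
    if "finite F" "finite G" for F G
  proof -
    have "(\<Sum>i\<in>F. (\<Sum>j\<in>G. h (sup_norm (i - j)) * c j) powr q * w i)
        \<le> opC powr q * mass TYPE('d) h powr q * (\<Sum>j\<in>G. c j powr q * w j)"
      unfolding opC_powr using that Lq_nonneg[OF c] by (intro sum_conv_powr_le[OF h]) auto
    also have "\<dots> \<le> opC powr q * mass TYPE('d) h powr q * nrm c powr q"
      using that by (intro mult_left_mono sum_le_nrm_powr c) auto
    also have "\<dots> = ?B powr q"
      using opC_nonneg mass_nonneg[OF h] nrm_nonneg by (simp add: powr_mult)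
    finally show ?thesis .
  qed
  show summable: "(\<lambda>j. h (sup_norm (i - j)) * c j) summable_on UNIV" for i
  proof (rule nonneg_bdd_above_summable_on)
    have "(\<Sum>j\<in>G. h (sup_norm (i - j)) * c j) \<le> (?B powr q / w i) powr (1 / q)" if "finite G" for G
    proof -
      have "(\<Sum>j\<in>G. h (sup_norm (i - j)) * c j) powr q \<le> ?B powr q / w i"
        using *[of "{i}" G] that w_pos[of i] by (simp add: field_simps)
      then have "((\<Sum>j\<in>G. h (sup_norm (i - j)) * c j) powr q) powr (1 / q) \<le> (?B powr q / w i) powr (1 / q)"
        using q by (intro powr_mono2) auto
      then show ?thesis
        using q nn by (simp add: powr_powr sum_nonneg)
    qed
    then show "bdd_above (sum (\<lambda>j. h (sup_norm (i - j)) * c j) ` {F. F \<subseteq> UNIV \<and> finite F})"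
      by (auto simp: bdd_above_def)
  qed (rule nn)
  show conv_nn: "0 \<le> conv h c i" for i
    unfolding conv_def by (intro infsum_nonneg nn)
  have "(\<Sum>i\<in>F. conv h c i powr q * w i) \<le> ?B powr q" if "finite F" for F
  proof (rule tendsto_upperbound)
    show "((\<lambda>G. \<Sum>i\<in>F. (\<Sum>j\<in>G. h (sup_norm (i - j)) * c j) powr q * w i) \<longlongrightarrow>
        (\<Sum>i\<in>F. conv h c i powr q * w i)) (finite_subsets_at_top UNIV)"
      unfolding conv_def using q nn
      by (intro tendsto_sum tendsto_mult_right tendsto_powr' infsum_tendsto summable tendsto_const)
         (auto intro!: always_eventually sum_nonneg)
    show "\<forall>\<^sub>F G in finite_subsets_at_top UNIV.
        (\<Sum>i\<in>F. (\<Sum>j\<in>G. h (sup_norm (i - j)) * c j) powr q * w i) \<le> ?B powr q"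
      using * that by (intro eventually_finite_subsets_at_top_weakI) auto
  qed simp
  then show "Lq (conv h c)" "nrm (conv h c) \<le> ?B"
    by (auto intro!: LqI[OF _ B] nrm_le[OF _ B] conv_nn)
qed

end

subsection \<open>Discrete Muckenhoupt weights\<close>

text \<open>For q = 1 the infimum of w is moved into the sum of f and replaced by w. For q > 1,
  Jensen is applied to f = \<sigma> * (f / \<sigma>) with weights \<sigma>, and the defining
  condition bounds the product of the two means.\<close>

lemma muckenhoupt_of_discrete_Aq:
  fixes w :: "int ^ 'd::finite \<Rightarrow> real"
  assumes q: "1 \<le> q" and Aq: "discrete_Aq_weight q w"
  obtains C where "muckenhoupt q w C"
proof (cases "q = 1")
  case True
  with Aq obtain C where w: "\<And>i. 0 < w i"
    and C: "\<And>a N. 1 \<le> N \<Longrightarrow> cube_mean w a N \<le> C * (INF i\<in>cube a N. w i)"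
    by (auto simp: discrete_Aq_weight_def discrete_A1_weight_def)
  have "muckenhoupt q w (max C 0)"
  proof
    fix N :: nat and a :: "int ^ 'd" and f :: "int ^ 'd \<Rightarrow> real"
    assume N: "1 \<le> N" and f: "\<And>i. 0 \<le> f i"
    let ?I = "INF i\<in>cube a N. w i"
    have "a \<in> cube a N"
      using N by (simp add: cube_def)
    then have I: "0 \<le> ?I"
      using w by (intro cINF_greatest) (auto simp: less_imp_le)
    have I_le: "?I \<le> w i" if "i \<in> cube a N" for i
      using that by (intro cINF_lower bdd_below_finite finite_imageI finite_cube)
    have "(\<Sum>i\<in>cube a N. w i) \<le> C * ?I * real N ^ CARD('d)"
      using C[OF N, of a] N by (simp add: cube_mean_def divide_le_eq)
    also have "\<dots> \<le> max C 0 * ?I * real N ^ CARD('d)"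
      using I by (intro mult_right_mono) auto
    finally have "(\<Sum>i\<in>cube a N. f i) * (\<Sum>i\<in>cube a N. w i)
        \<le> (\<Sum>i\<in>cube a N. f i) * (max C 0 * ?I * real N ^ CARD('d))"
      using f by (intro mult_left_mono sum_nonneg)
    also have "\<dots> = max C 0 * real N ^ CARD('d) * (\<Sum>i\<in>cube a N. f i * ?I)"
      by (simp add: sum_distrib_left sum_distrib_right mult_ac)
    also have "\<dots> \<le> max C 0 * real N ^ CARD('d) * (\<Sum>i\<in>cube a N. f i * w i)"
      using f I_le by (intro mult_left_mono sum_mono) auto
    finally show "(\<Sum>i\<in>cube a N. f i) powr q * (\<Sum>i\<in>cube a N. w i)
        \<le> max C 0 * (real N ^ CARD('d)) powr q * (\<Sum>i\<in>cube a N. f i powr q * w i)"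
      using True f by (simp add: sum_nonneg)
  qed (use True w in auto)
  then show ?thesis ..
next
  case False
  with q have "1 < q" by simp
  \<comment> \<open>The dual weight, for which \<sigma> powr (1 - q) = w; hence \<sigma> * (f /
    \<sigma>) powr q is the weighted summand f powr q * w.\<close>
  define \<sigma> where "\<sigma> = (\<lambda>i. w i powr (- 1 / (q - 1)))"
  from False Aq obtain C where w: "\<And>i. 0 < w i"
    and C: "\<And>a N. 1 \<le> N \<Longrightarrow> cube_mean w a N * cube_mean \<sigma> a N powr (q - 1) \<le> C"
    by (auto simp: discrete_Aq_weight_def \<sigma>_def)
  have "muckenhoupt q w C"
  proof
    fix N :: nat and a :: "int ^ 'd" and f :: "int ^ 'd \<Rightarrow> real"
    assume N: "1 \<le> N" and f: "\<And>i. 0 \<le> f i"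
    define V where "V = real N ^ CARD('d)"
    have V: "0 < V"
      using N by (simp add: V_def)
    have \<sigma>: "0 < \<sigma> i" for i
      using w[of i] by (simp add: \<sigma>_def)
    have "\<sigma> i * (f i / \<sigma> i) powr q = f i powr q * w i" for i
    proof -
      have "\<sigma> i * (f i / \<sigma> i) powr q = f i powr q * (\<sigma> i powr 1 * \<sigma> i powr (- q))"
        using \<sigma>[of i] f by (simp add: powr_divide powr_minus_divide less_imp_le)
      also have "\<sigma> i powr 1 * \<sigma> i powr (- q) = w i powr ((- 1 / (q - 1)) * (1 - q))"
        unfolding powr_add[symmetric] by (simp add: \<sigma>_def powr_powr)
      also have "(- 1 / (q - 1)) * (1 - q) = 1"
        using \<open>1 < q\<close> by (simp add: field_simps)
      finally show ?thesis
        using w[of i] by simp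
    qed
    then have "(\<Sum>i\<in>cube a N. f i) powr q
        \<le> (\<Sum>i\<in>cube a N. \<sigma> i) powr (q - 1) * (\<Sum>i\<in>cube a N. f i powr q * w i)"
      using jensen_powr[OF q, of "cube a N" \<sigma> "\<lambda>i. f i / \<sigma> i"] f \<sigma> finite_cube[of a N]
      by (simp add: less_imp_le less_imp_neq[THEN not_sym])
    then have "(\<Sum>i\<in>cube a N. f i) powr q * (\<Sum>i\<in>cube a N. w i)
        \<le> (\<Sum>i\<in>cube a N. \<sigma> i) powr (q - 1) * (\<Sum>i\<in>cube a N. f i powr q * w i) * (\<Sum>i\<in>cube a N. w i)"
      using w by (intro mult_right_mono sum_nonneg) (auto simp: less_imp_le)
    also have "\<dots> = ((\<Sum>i\<in>cube a N. w i) * (\<Sum>i\<in>cube a N. \<sigma> i) powr (q - 1)) * (\<Sum>i\<in>cube a N. f i powr q * w i)"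
      by (simp add: mult_ac)
    also have "\<dots> \<le> (C * V powr q) * (\<Sum>i\<in>cube a N. f i powr q * w i)"
    proof (intro mult_right_mono sum_nonneg)
      have "(\<Sum>i\<in>cube a N. w i) / V * ((\<Sum>i\<in>cube a N. \<sigma> i) powr (q - 1) / V powr (q - 1)) \<le> C"
        using C[OF N, of a] V \<sigma> by (simp add: cube_mean_def V_def powr_divide sum_nonneg less_imp_le)
      then show "(\<Sum>i\<in>cube a N. w i) * (\<Sum>i\<in>cube a N. \<sigma> i) powr (q - 1) \<le> C * V powr q"
        using V by (simp add: powr_diff[of V] field_simps)
    qed (use w in \<open>auto simp: less_imp_le\<close>)
    finally show "(\<Sum>i\<in>cube a N. f i) powr q * (\<Sum>i\<in>cube a N. w i)
        \<le> C * (real N ^ CARD('d)) powr q * (\<Sum>i\<in>cube a N. f i powr q * w i)"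
      by (simp add: V_def)
  qed (use q w in auto)
  then show ?thesis ..
qed

section \<open>Dominated series and finite sums of series\<close>

lemma
  fixes f :: "'a \<Rightarrow> 'b::banach" and g :: "'a \<Rightarrow> real"
  assumes g: "g summable_on A" and le: "\<And>x. norm (f x) \<le> g x"
  shows summable_on_dominated: "f summable_on A"
    and norm_infsum_dominated: "norm (infsum f A) \<le> infsum g A"
proof -
  have "(\<lambda>x. norm (f x)) summable_on A"
    using g by (rule summable_on_comparison_test) (use le in auto)
  then show *: "f summable_on A"
    by (rule abs_summable_summable)
  show "norm (infsum f A) \<le> infsum g A"
    using * g le by (intro norm_infsum_le[OF has_sum_infsum has_sum_infsum]) auto
qed

lemma has_sum_sum:
  fixes f :: "'a \<Rightarrow> 'b \<Rightarrow> 'c::topological_comm_monoid_add"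
  assumes "finite F" "\<And>x. x \<in> F \<Longrightarrow> (f x has_sum s x) A"
  shows "((\<lambda>y. \<Sum>x\<in>F. f x y) has_sum (\<Sum>x\<in>F. s x)) A"
  using assms by (induction F) (auto intro: has_sum_add)

subsection \<open>Matrix products\<close>

definition mat_mult :: "('i \<Rightarrow> 'i \<Rightarrow> complex) \<Rightarrow> ('i \<Rightarrow> 'i \<Rightarrow> complex) \<Rightarrow> 'i \<Rightarrow> 'i \<Rightarrow> complex"
  where "mat_mult a b = (\<lambda>i j. \<Sum>\<^sub>\<infinity>k\<in>UNIV. a i k * b k j)"

text \<open>Both factors are dominated by one doubling profile u, the envelope of h + g, and the
  convolution of u with itself is at most a multiple of u.\<close>

lemma mat_mult_in_B_matrices:
  fixes a b :: "int ^ 'd::finite \<Rightarrow> int ^ 'd \<Rightarrow> complex"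
  assumes "a \<in> B_matrices" "b \<in> B_matrices"
  shows "mat_mult a b \<in> B_matrices"
proof -
  obtain h where h: "profile TYPE('d) h" "\<And>i j. cmod (a i j) \<le> h (sup_norm (i - j))"
    using B_matricesE[OF assms(1)] by metis
  obtain g where g: "profile TYPE('d) g" "\<And>i j. cmod (b i j) \<le> g (sup_norm (i - j))"
    using B_matricesE[OF assms(2)] by metis
  obtain u where u: "profile TYPE('d) u" "\<And>n. h n + g n \<le> u n"
    "\<And>n. u (n div 2) \<le> u n / (1 / (2 * 3 ^ CARD('d)))"
    using doubling_envelope[OF profile_add[OF h(1) g(1)]] by metis
  define M where "M = 2 * (2 * 3 ^ CARD('d)) * mass TYPE('d) u"
  have u_le: "u (n div 2) \<le> (2 * 3 ^ CARD('d)) * u n" for n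
    using u(3)[of n] by (simp add: mult.commute)
  have a_le: "cmod (a i j) \<le> u (sup_norm (i - j))" and b_le: "cmod (b i j) \<le> u (sup_norm (i - j))" for i j
    using h(2)[of i j] g(2)[of i j] u(2)[of "sup_norm (i - j)"]
      profile_nonneg[OF h(1), of "sup_norm (i - j)"] profile_nonneg[OF g(1), of "sup_norm (i - j)"] by linarith+
  have "cmod (mat_mult a b i j) \<le> M * u (sup_norm (i - j))" for i j
  proof -
    have bound: "(\<Sum>k\<in>F. cmod (a i k * b k j)) \<le> M * u (sup_norm (i - j))" if "finite F" for F
    proof -
      have "(\<Sum>k\<in>F. cmod (a i k * b k j)) \<le> (\<Sum>k\<in>F. u (sup_norm (i - k)) * u (sup_norm (k - j)))"
        unfolding norm_mult by (intro sum_mono mult_mono a_le b_le profile_nonneg[OF u(1)]) auto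
      also have "\<dots> \<le> M * u (sup_norm (i - j))"
        unfolding M_def by (rule doubling_convolution[OF u(1) u_le that])
      finally show ?thesis .
    qed
    then have s: "(\<lambda>k. cmod (a i k * b k j)) summable_on UNIV"
      by (intro nonneg_bdd_above_summable_on) (auto simp: bdd_above_def)
    have "cmod (mat_mult a b i j) \<le> (\<Sum>\<^sub>\<infinity>k\<in>UNIV. cmod (a i k * b k j))"
      unfolding mat_mult_def using s by (rule norm_infsum_bound)
    also have "\<dots> \<le> M * u (sup_norm (i - j))"
      using s bound by (rule infsum_le_finite_sums)
    finally show ?thesis .
  qed
  moreover have "profile TYPE('d) (\<lambda>n. M * u n)"
    unfolding M_def by (intro profile_cmult[OF u(1)] mult_nonneg_nonneg mass_nonneg[OF u(1)]) auto
  ultimately show ?thesis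
    by (auto simp: B_matrices_iff)
qed

context muckenhoupt
begin

lemma
  assumes h: "profile TYPE('d) h" "\<And>i j. cmod (a i j) \<le> h (sup_norm (i - j))" and c: "c \<in> lqw q w"
  shows summable_mat_apply: "(\<lambda>j. a i j * c j) summable_on UNIV"
    and mat_apply_in_lqw: "mat_apply a c \<in> lqw q w"
    and lqw_norm_mat_apply_le: "lqw_norm q w (mat_apply a c) \<le> opC * mass TYPE('d) h * lqw_norm q w c"
proof -
  have c': "Lq (\<lambda>j. cmod (c j))"
    using c by (simp add: lqw_iff)
  have le: "cmod (a i j * c j) \<le> h (sup_norm (i - j)) * cmod (c j)" for i j
    unfolding norm_mult by (intro mult_right_mono h) auto
  show "(\<lambda>j. a i j * c j) summable_on UNIV" for i
    by (rule summable_on_dominated[OF summable_conv[OF h(1) c'] le])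
  have conv_le: "cmod (mat_apply a c i) \<le> conv h (\<lambda>j. cmod (c j)) i" for i
    unfolding conv_def mat_apply_def by (rule norm_infsum_dominated[OF summable_conv[OF h(1) c'] le])
  show "mat_apply a c \<in> lqw q w"
    unfolding lqw_iff by (rule Lq_mono[OF Lq_conv[OF h(1) c']]) (auto intro: conv_le)
  have "lqw_norm q w (mat_apply a c) \<le> nrm (conv h (\<lambda>j. cmod (c j)))"
    unfolding lqw_norm_eq by (rule nrm_mono[OF Lq_conv[OF h(1) c']]) (auto intro: conv_le)
  also have "\<dots> \<le> opC * mass TYPE('d) h * lqw_norm q w c"
    unfolding lqw_norm_eq by (rule nrm_conv[OF h(1) c'])
  finally show "lqw_norm q w (mat_apply a c) \<le> opC * mass TYPE('d) h * lqw_norm q w c" .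
qed

text \<open>Fubini. Absolute summability over pairs is checked by enclosing a finite set of pairs in
  a rectangle, whose sum is at most the iterated convolution of |c| with the two profiles.\<close>

lemma mat_apply_mat_mult:
  assumes a: "a \<in> B_matrices" and b: "b \<in> B_matrices" and c: "c \<in> lqw q w"
  shows "mat_apply (mat_mult a b) c = mat_apply a (mat_apply b c)"
proof
  fix i
  obtain h where h: "profile TYPE('d) h" "\<And>i j. cmod (a i j) \<le> h (sup_norm (i - j))"
    using a by (auto simp: B_matrices_iff)
  obtain g where g: "profile TYPE('d) g" "\<And>i j. cmod (b i j) \<le> g (sup_norm (i - j))"
    using b by (auto simp: B_matrices_iff)
  have c': "Lq (\<lambda>j. cmod (c j))"
    using c by (simp add: lqw_iff)
  let ?f = "\<lambda>k j. a i k * (b k j * c j)"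
  let ?G = "conv g (\<lambda>j. cmod (c j))"
  have "(\<Sum>p\<in>F. cmod (case p of (k, j) \<Rightarrow> ?f k j)) \<le> conv h ?G i" if "finite F" for F
  proof -
    have "(\<Sum>p\<in>F. cmod (case p of (k, j) \<Rightarrow> ?f k j)) \<le> (\<Sum>p\<in>fst ` F \<times> snd ` F. cmod (case p of (k, j) \<Rightarrow> ?f k j))"
      using that by (intro sum_mono2) (auto simp: image_iff, force+)
    also have "\<dots> = (\<Sum>k\<in>fst ` F. \<Sum>j\<in>snd ` F. cmod (?f k j))"
      by (subst sum.cartesian_product') simp
    also have "\<dots> = (\<Sum>k\<in>fst ` F. cmod (a i k) * (\<Sum>j\<in>snd ` F. cmod (b k j) * cmod (c j)))"
      by (simp add: norm_mult sum_distrib_left)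
    also have "\<dots> \<le> (\<Sum>k\<in>fst ` F. h (sup_norm (i - k)) * ?G k)"
    proof (intro sum_mono mult_mono h)
      fix k
      have "(\<Sum>j\<in>snd ` F. cmod (b k j) * cmod (c j)) \<le> (\<Sum>j\<in>snd ` F. g (sup_norm (k - j)) * cmod (c j))"
        by (intro sum_mono mult_right_mono g) auto
      also have "\<dots> \<le> ?G k"
        unfolding conv_def using that profile_nonneg[OF g(1)]
        by (intro finite_sum_le_infsum summable_conv[OF g(1) c']) auto
      finally show "(\<Sum>j\<in>snd ` F. cmod (b k j) * cmod (c j)) \<le> ?G k" .
    qed (auto intro!: profile_nonneg[OF h(1)] sum_nonneg)
    also have "\<dots> \<le> conv h ?G i"
      unfolding conv_def[of h] using that profile_nonneg[OF h(1)] conv_nonneg[OF g(1) c']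
      by (intro finite_sum_le_infsum summable_conv[OF h(1)] Lq_conv[OF g(1) c']) auto
    finally show ?thesis .
  qed
  then have "(\<lambda>p. cmod (case p of (k, j) \<Rightarrow> ?f k j)) summable_on UNIV \<times> UNIV"
    by (intro nonneg_bdd_above_summable_on) (auto simp: bdd_above_def)
  then have s: "(\<lambda>(k, j). ?f k j) summable_on UNIV \<times> UNIV"
    by (rule abs_summable_summable)
  have "mat_apply a (mat_apply b c) i = (\<Sum>\<^sub>\<infinity>k\<in>UNIV. \<Sum>\<^sub>\<infinity>j\<in>UNIV. ?f k j)"
    unfolding mat_apply_def by (simp add: infsum_cmult_right')
  also have "\<dots> = (\<Sum>\<^sub>\<infinity>j\<in>UNIV. \<Sum>\<^sub>\<infinity>k\<in>UNIV. ?f k j)"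
    by (rule infsum_swap_banach[OF s])
  also have "\<dots> = (\<Sum>\<^sub>\<infinity>j\<in>UNIV. mat_mult a b i j * c j)"
    unfolding mat_mult_def by (simp add: infsum_cmult_left' mult.assoc[symmetric])
  finally show "mat_apply (mat_mult a b) c i = mat_apply a (mat_apply b c) i"
    by (simp add: mat_apply_def)
qed

subsection \<open>Local averages\<close>

definition restr :: "(int ^ 'd) set \<Rightarrow> (int ^ 'd \<Rightarrow> real) \<Rightarrow> int ^ 'd \<Rightarrow> real"
  where "restr S c j = (if j \<in> S then c j else 0)"

lemma Lq_restr: "Lq c \<Longrightarrow> Lq (restr S c)"
  by (rule Lq_mono[of c]) (auto simp: restr_def Lq_nonneg)

text \<open>Dividing by the weight of the ball makes values at different points comparable, so the
  convolution inequality for these averages has translation-invariant coefficients.\<close>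

definition local_avg :: "nat \<Rightarrow> (int ^ 'd \<Rightarrow> real) \<Rightarrow> int ^ 'd \<Rightarrow> real"
  where "local_avg N c x = ((\<Sum>j\<in>lball x N. c j powr q * w j) / ball_weight x N) powr (1 / q)"

lemma local_avg_nonneg: "0 \<le> local_avg N c x"
  by (simp add: local_avg_def)

lemma local_avg_powr: "local_avg N c x powr q = (\<Sum>j\<in>lball x N. c j powr q * w j) / ball_weight x N"
proof -
  have "0 \<le> (\<Sum>j\<in>lball x N. c j powr q * w j) / ball_weight x N"
    using ball_weight_pos[of x N] by (intro divide_nonneg_pos sum_nonneg) (auto simp: w_nonneg)
  moreover have "(A powr (1 / q)) powr q = A" if "0 \<le> A" for A
    using q that by (simp add: powr_powr)
  ultimately show ?thesis
    unfolding local_avg_def by blast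
qed

text \<open>This is \<open>sum_local_mean_le\<close> for the summands of the norm. It makes
  \<open>conv u \<alpha>\<close> a convergent series, so that part of it can be absorbed in
  \<open>conv_inequality_solve\<close>.\<close>

lemma Lq_local_avg:
  assumes c: "Lq c"
  shows "Lq (local_avg N c)"
proof (rule LqI)
  let ?B = "dbl 2 powr (1 / q) * nrm c"
  show "0 \<le> ?B"
    by (simp add: nrm_nonneg)
  fix F :: "(int ^ 'd) set" assume F: "finite F"
  define G where "G = (\<Union>i\<in>F. lball i N)"
  have G: "finite G"
    using F by (simp add: G_def)
  have "(\<Sum>i\<in>F. local_avg N c i powr q * w i)
      = (\<Sum>i\<in>F. w i * ((\<Sum>j\<in>G \<inter> lball i N. c j powr q * w j) / ball_weight i N))"
    by (intro sum.cong refl) (auto simp: local_avg_powr G_def mult.commute intro!: arg_cong2[of _ _ _ _ "(/)"] sum.cong)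
  also have "\<dots> \<le> dbl 2 * (\<Sum>j\<in>G. c j powr q * w j)"
    by (intro sum_local_mean_le F G) (simp add: w_nonneg)
  also have "\<dots> \<le> dbl 2 * nrm c powr q"
    by (intro mult_left_mono sum_le_nrm_powr c G dbl_nonneg)
  also have "\<dots> = ?B powr q"
    using q nrm_nonneg dbl_nonneg by (simp add: powr_mult powr_powr)
  finally show "(\<Sum>i\<in>F. local_avg N c i powr q * w i) \<le> ?B powr q" .
qed (simp add: local_avg_nonneg)

lemma nrm_restr_lball:
  assumes "\<And>j. 0 \<le> c j"
  shows "nrm (restr (lball x N) c) = local_avg N c x * ball_weight x N powr (1 / q)"
proof -
  have "nrm (restr (lball x N) c) = (\<Sum>i\<in>lball x N. restr (lball x N) c i powr q * w i) powr (1 / q)"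
    using assms by (intro nrm_finite_support) (auto simp: restr_def)
  also have "(\<Sum>i\<in>lball x N. restr (lball x N) c i powr q * w i) = (\<Sum>i\<in>lball x N. c i powr q * w i)"
    by (intro sum.cong) (auto simp: restr_def)
  also have "\<dots> = local_avg N c x powr q * ball_weight x N"
    using ball_weight_pos[of x N] by (simp add: local_avg_powr)
  finally show ?thesis
    using q local_avg_nonneg ball_weight_pos[of x N] by (simp add: powr_mult powr_powr less_imp_le)
qed

lemma sum_lball_le_local_avg:
  assumes "\<And>j. 0 \<le> c j"
  shows "(\<Sum>j\<in>lball x N. c j) \<le> C powr (1 / q) * (vol TYPE('d) N * local_avg N c x)"
proof -
  have "(\<Sum>j\<in>lball x N. c j) powr q \<le> C * vol TYPE('d) N powr q * local_avg N c x powr q"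
    using mean_le_ball[of c x N] assms ball_weight_pos[of x N] by (simp add: local_avg_powr field_simps)
  then have "((\<Sum>j\<in>lball x N. c j) powr q) powr (1 / q)
      \<le> (C * vol TYPE('d) N powr q * local_avg N c x powr q) powr (1 / q)"
    using q by (intro powr_mono2) auto
  then show ?thesis
    using q assms C_pos local_avg_nonneg by (simp add: powr_powr powr_mult sum_nonneg less_imp_le mult.assoc)
qed

lemma ball_weight_powr_le:
  assumes "ball_weight y r \<le> D * ball_weight x s" "0 \<le> D"
  shows "ball_weight y r powr (1 / q) \<le> D powr (1 / q) * ball_weight x s powr (1 / q)"
proof -
  have "ball_weight y r powr (1 / q) \<le> (D * ball_weight x s) powr (1 / q)"
    using q assms ball_weight_pos[of y r] by (intro powr_mono2) (auto simp: less_imp_le)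
  then show ?thesis
    using assms ball_weight_pos[of x s] by (simp add: powr_mult less_imp_le)
qed

lemma conv_indicator: "conv (\<lambda>n. if n \<le> R then 1 else 0) f x = (\<Sum>y\<in>lball x R. f y)"
proof -
  have "conv (\<lambda>n. if n \<le> R then 1 else 0) f x = infsum f (lball x R)"
    unfolding conv_def by (intro infsum_cong_neutral) (auto simp: lball_def sup_norm_minus_commute)
  then show ?thesis
    by simp
qed

text \<open>Each point of the 8N-ball lies in exactly vol N of the N-balls centred in the 9N-ball,
  so c there is an average of its restrictions to N-balls. These all lie in the 10N-ball, whence the
  doubling constant.\<close>

lemma nrm_restr_near:
  assumes c: "Lq c"
  shows "nrm (restr (lball x (8 * N)) c)
    \<le> dbl 10 powr (1 / q) / vol TYPE('d) N * (\<Sum>y\<in>lball x (9 * N). local_avg N c y) * ball_weight x N powr (1 / q)"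
proof -
  let ?V = "vol TYPE('d) N"
  let ?S = "\<lambda>j. \<Sum>y\<in>lball x (9 * N). restr (lball y N) c j"
  have S: "Lq ?S"
    by (intro Lq_sum Lq_restr c) auto
  have le: "restr (lball x (8 * N)) c j \<le> 1 / ?V * ?S j" for j
  proof (cases "j \<in> lball x (8 * N)")
    case True
    then have "lball j N \<subseteq> lball x (9 * N)"
      by (intro lball_subset) (simp add: lball_def)
    then have "lball x (9 * N) \<inter> {y. j \<in> lball y N} = lball j N"
      by (auto simp: lball_sym)
    then have "?S j = ?V * c j"
      by (simp add: restr_def sum.If_cases card_lball vol_def)
    then show ?thesis
      using True by (simp add: restr_def)
  next
    case False
    then show ?thesis
      using Lq_nonneg[OF S, of j] by (simp add: restr_def[of "lball x (8 * N)"] less_imp_le)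
  qed
  have "nrm (restr (lball x (8 * N)) c) \<le> nrm (\<lambda>j. 1 / ?V * ?S j)"
    using Lq_nonneg[OF c] by (intro nrm_mono[OF Lq_cmult[OF S]] le) (auto simp: restr_def less_imp_le)
  also have "\<dots> \<le> 1 / ?V * nrm ?S"
    by (intro nrm_cmult S) (simp add: less_imp_le)
  also have "\<dots> \<le> 1 / ?V * (\<Sum>y\<in>lball x (9 * N). nrm (restr (lball y N) c))"
    by (intro mult_left_mono nrm_sum Lq_restr c) (auto simp: less_imp_le)
  also have "\<dots> \<le> 1 / ?V * (\<Sum>y\<in>lball x (9 * N). local_avg N c y * (dbl 10 powr (1 / q) * ball_weight x N powr (1 / q)))"
  proof (intro mult_left_mono sum_mono)
    fix y assume "y \<in> lball x (9 * N)"
    then have "lball y N \<subseteq> lball x (10 * N)"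
      by (intro lball_subset) (simp add: lball_def)
    then have "ball_weight y N \<le> ball_weight x (10 * N)"
      by (intro sum_mono2) (auto simp: w_nonneg)
    also have "\<dots> \<le> dbl 10 * ball_weight x N"
      by (intro ball_weight_doubling lball_subset) auto
    finally show "nrm (restr (lball y N) c) \<le> local_avg N c y * (dbl 10 powr (1 / q) * ball_weight x N powr (1 / q))"
      unfolding nrm_restr_lball[OF Lq_nonneg[OF c]]
      by (intro mult_left_mono ball_weight_powr_le local_avg_nonneg dbl_nonneg)
  qed (simp add: less_imp_le)
  finally show ?thesis
    by (simp add: sum_distrib_left sum_distrib_right sum_divide_distrib mult_ac)
qed

text \<open>Each j is spread over the N-ball around it. As |x - j| > 8N, moving j by N changes its
  distance to x only slightly, which passing from \<open>div 2\<close> to \<open>div 4\<close>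
  absorbs. The \<open>max\<close> with N makes the mass of the new profile small for large
  N.\<close>

lemma conv_restr_far:
  assumes h: "profile TYPE('d) h" and c: "Lq c"
  shows "conv (\<lambda>n. h (n div 2)) (restr (- lball x (8 * N)) c) x
    \<le> C powr (1 / q) * conv (\<lambda>n. h (max n N div 4)) (local_avg N c) x"
proof -
  let ?V = "vol TYPE('d) N" and ?g = "\<lambda>n. h (max n N div 4)"
  have "profile TYPE('d) (\<lambda>n. h (n div 2 ^ 2))"
    by (rule profile_dyadic[OF h])
  then have g: "profile TYPE('d) ?g"
    using profile_max by fastforce
  show ?thesis
    unfolding conv_def[of "\<lambda>n. h (n div 2)"]
  proof (rule infsum_le_finite_sums[OF summable_conv[OF profile_half[OF h] Lq_restr[OF c]]])
    fix F0 :: "(int ^ 'd) set" assume "finite F0"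
    define F where "F = F0 - lball x (8 * N)"
    have F: "finite F"
      using \<open>finite F0\<close> by (simp add: F_def)
    define Y where "Y = (\<Union>j\<in>F. lball j N)"
    have Y: "finite Y"
      using F by (simp add: Y_def)
    have geom: "h (sup_norm (x - j) div 2) \<le> ?g (sup_norm (x - y))" if "j \<in> F" "j \<in> lball y N" for j y
    proof -
      have "sup_norm (x - y) \<le> sup_norm (x - j) + N" "8 * N < sup_norm (x - j)"
        using that sup_norm_triangle_diff[of x y j]
        by (auto simp: F_def lball_def sup_norm_minus_commute)
      then have "max (sup_norm (x - y)) N div 4 \<le> sup_norm (x - j) div 2"
        by linarith
      then show ?thesis
        by (rule profile_antimono[OF h])
    qed
    have "?V * (\<Sum>j\<in>F. h (sup_norm (x - j) div 2) * c j)
        = (\<Sum>j\<in>F. \<Sum>y | y \<in> Y \<and> j \<in> lball y N. h (sup_norm (x - j) div 2) * c j)"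
    proof -
      have "{y. y \<in> Y \<and> j \<in> lball y N} = lball j N" if "j \<in> F" for j
        using that by (auto simp: Y_def lball_sym)
      then show ?thesis
        by (simp add: sum_distrib_left card_lball vol_def)
    qed
    also have "\<dots> = (\<Sum>y\<in>Y. \<Sum>j | j \<in> F \<and> j \<in> lball y N. h (sup_norm (x - j) div 2) * c j)"
      by (rule sum.swap_restrict[OF F Y])
    also have "\<dots> \<le> (\<Sum>y\<in>Y. \<Sum>j | j \<in> F \<and> j \<in> lball y N. ?g (sup_norm (x - y)) * c j)"
      by (intro sum_mono mult_right_mono geom Lq_nonneg[OF c]) auto
    also have "\<dots> \<le> (\<Sum>y\<in>Y. \<Sum>j\<in>lball y N. ?g (sup_norm (x - y)) * c j)"
      by (intro sum_mono sum_mono2 mult_nonneg_nonneg profile_nonneg[OF h] Lq_nonneg[OF c]) auto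
    also have "\<dots> \<le> (\<Sum>y\<in>Y. ?g (sup_norm (x - y)) * (C powr (1 / q) * (?V * local_avg N c y)))"
      unfolding sum_distrib_left[symmetric]
      by (intro sum_mono mult_left_mono sum_lball_le_local_avg profile_nonneg[OF h] Lq_nonneg[OF c])
    also have "\<dots> = ?V * (C powr (1 / q) * (\<Sum>y\<in>Y. ?g (sup_norm (x - y)) * local_avg N c y))"
      by (simp add: sum_distrib_left mult_ac)
    also have "\<dots> \<le> ?V * (C powr (1 / q) * conv ?g (local_avg N c) x)"
      unfolding conv_def using Y
      by (intro mult_left_mono finite_sum_le_infsum summable_conv[OF g] Lq_local_avg c
          mult_nonneg_nonneg profile_nonneg[OF h] local_avg_nonneg) (auto simp: less_imp_le)
    finally have "(\<Sum>j\<in>F. h (sup_norm (x - j) div 2) * c j) \<le> C powr (1 / q) * conv ?g (local_avg N c) x"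
      by (rule mult_left_le_imp_le) simp
    also have "(\<Sum>j\<in>F. h (sup_norm (x - j) div 2) * c j)
        = (\<Sum>j\<in>F0. h (sup_norm (x - j) div 2) * restr (- lball x (8 * N)) c j)"
      using \<open>finite F0\<close> by (intro sum.mono_neutral_cong_left) (auto simp: F_def restr_def)
    finally show "(\<Sum>j\<in>F0. h (sup_norm (x - j) div 2) * restr (- lball x (8 * N)) c j)
        \<le> C powr (1 / q) * conv ?g (local_avg N c) x" .
  qed
qed

end

subsection \<open>A commutator estimate\<close>

definition unit_seq :: "'i \<Rightarrow> 'i \<Rightarrow> complex"
  where "unit_seq m = (\<lambda>i. if i = m then 1 else 0)"

lemma lball_0: "lball (x :: int ^ 'd::finite) 0 = {x}"
  by (auto simp: lball_def vec_eq_iff sup_norm_le_iff[of _ 0, simplified])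

text \<open>A linear ramp between the radii N and 2N; its Lipschitz constant 1/N makes the near part
  of the commutator small.\<close>

definition cutoff :: "nat \<Rightarrow> int ^ 'd::finite \<Rightarrow> int ^ 'd \<Rightarrow> real"
  where "cutoff N x i = max 0 (min 1 (2 - real (sup_norm (i - x)) / real N))"

lemma cutoff_nonneg: "0 \<le> cutoff N x i"
  and cutoff_le_1: "cutoff N x i \<le> 1"
  by (auto simp: cutoff_def)

lemma cutoff_eq_1: "1 \<le> N \<Longrightarrow> i \<in> lball x N \<Longrightarrow> cutoff N x i = 1"
  and cutoff_eq_0: "1 \<le> N \<Longrightarrow> i \<notin> lball x (2 * N) \<Longrightarrow> cutoff N x i = 0"
  by (auto simp: cutoff_def lball_def field_simps min_def max_def)

lemma cutoff_diff_le: "1 \<le> N \<Longrightarrow> \<bar>cutoff N x j - cutoff N x i\<bar> \<le> real (sup_norm (i - j)) / real N"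
proof -
  assume N: "1 \<le> N"
  have "\<bar>real (sup_norm (i - x)) - real (sup_norm (j - x))\<bar> \<le> real (sup_norm (i - j))"
    using sup_norm_triangle_diff[of i x j] sup_norm_triangle_diff[of j x i]
    by (simp add: sup_norm_minus_commute[of j i])
  then have "\<bar>real (sup_norm (i - x)) / real N - real (sup_norm (j - x)) / real N\<bar> \<le> real (sup_norm (i - j)) / real N"
    using N by (simp add: diff_divide_distrib[symmetric] divide_right_mono)
  then show ?thesis
    unfolding cutoff_def by (simp add: max_def min_def abs_if split: if_splits)
qed

context muckenhoupt
begin

text \<open>The lower bound for A is applied to f = \<psi> c, and A f is \<psi> A c plus the
  commutator with entries a i j * (\<psi> j - \<psi> i). For j in the 8N-ball the difference is at
  most 1 and at most |i - j| / N, so either alternative for e dominates the entry. For other j,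
  \<psi> j = 0 and only i in the 2N-ball contribute.\<close>

lemma commutator_local_avg_le:
  assumes h: "profile TYPE('d) h" "\<And>i j. cmod (a i j) \<le> h (sup_norm (i - j))"
    and N: "1 \<le> N"
    and e: "profile TYPE('d) e" "\<And>n. h n \<le> e n \<or> real n / real N * h n \<le> e n"
    and K: "0 \<le> K" "\<And>f. f \<in> lqw q w \<Longrightarrow> lqw_norm q w f \<le> K * lqw_norm q w (mat_apply a f)"
    and c: "c \<in> lqw q w"
  defines "\<alpha> \<equiv> local_avg N (\<lambda>i. cmod (c i))"
  shows "\<alpha> x \<le> K * (nrm (restr (lball x (2 * N)) (\<lambda>i. cmod (mat_apply a c i))) / ball_weight x N powr (1 / q)
      + opC * mass TYPE('d) e * (dbl 10 powr (1 / q) / vol TYPE('d) N * (\<Sum>y\<in>lball x (9 * N). \<alpha> y))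
      + C powr (1 / q) * dbl 2 powr (1 / q) * conv (\<lambda>n. h (max n N div 4)) \<alpha> x)"
proof -
  define b where "b = ball_weight x N powr (1 / q)"
  have b: "0 < b"
    using ball_weight_pos[of x N] by (simp add: b_def)
  define \<psi> where "\<psi> = cutoff N x"
  define c' where "c' i = cmod (c i)" for i
  have c': "Lq c'"
    using c by (simp add: lqw_iff c'_def[abs_def])
  have Ac: "Lq (\<lambda>i. cmod (mat_apply a c i))"
    using mat_apply_in_lqw[OF h c] by (simp add: lqw_iff)
  define f where "f i = of_real (\<psi> i) * c i" for i
  have cmod_f: "cmod (f i) = \<psi> i * c' i" for i
    by (simp add: f_def norm_mult \<psi>_def cutoff_nonneg c'_def)
  have f: "f \<in> lqw q w"
    unfolding lqw_iff cmod_f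
    by (rule Lq_mono[OF c'])
       (auto simp: \<psi>_def cutoff_nonneg cutoff_le_1 Lq_nonneg[OF c'] intro!: mult_left_le_one_le)
  let ?near = "restr (lball x (8 * N)) c'" and ?far = "restr (- lball x (8 * N)) c'"
  have h2: "profile TYPE('d) (\<lambda>n. h (n div 2))"
    by (rule profile_half[OF h(1)])
  \<comment> \<open>A bound for the far part that is the same for all i in the 2N-ball, because
    distances are measured from x instead of i.\<close>
  define \<Gamma> where "\<Gamma> = conv (\<lambda>n. h (n div 2)) ?far x"
  have \<Gamma>: "0 \<le> \<Gamma>"
    unfolding \<Gamma>_def by (intro conv_nonneg[OF h2] Lq_restr c')
  define r1 where "r1 = restr (lball x (2 * N)) (\<lambda>i. cmod (mat_apply a c i))"
  define r3 where "r3 i = (if i \<in> lball x (2 * N) then \<Gamma> else 0)" for i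
  have r1: "Lq r1"
    unfolding r1_def by (intro Lq_restr Ac)
  have r2: "Lq (conv e ?near)"
    by (intro Lq_conv e Lq_restr c')
  have r3: "Lq r3"
    and nrm_r3: "nrm r3 = \<Gamma> * ball_weight x (2 * N) powr (1 / q)"
  proof -
    show "Lq r3"
      using \<Gamma> by (intro Lq_finite_support[of "lball x (2 * N)"]) (auto simp: r3_def)
    have "nrm r3 = (\<Sum>i\<in>lball x (2 * N). r3 i powr q * w i) powr (1 / q)"
      using \<Gamma> by (intro nrm_finite_support) (auto simp: r3_def)
    also have "(\<Sum>i\<in>lball x (2 * N). r3 i powr q * w i) = \<Gamma> powr q * ball_weight x (2 * N)"
      by (simp add: r3_def sum_distrib_left)
    finally show "nrm r3 = \<Gamma> * ball_weight x (2 * N) powr (1 / q)"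
      using q \<Gamma> ball_weight_pos[of x "2 * N"] by (simp add: powr_mult powr_powr less_imp_le)
  qed
  have pointwise: "cmod (mat_apply a f i) \<le> r1 i + (conv e ?near i + r3 i)" for i
  proof -
    let ?D = "\<lambda>j. a i j * of_real (\<psi> j - \<psi> i) * c j"
    let ?B = "\<lambda>j. e (sup_norm (i - j)) * ?near j
        + (if i \<in> lball x (2 * N) then h (sup_norm (x - j) div 2) * ?far j else 0)"
    have near_s: "(\<lambda>j. e (sup_norm (i - j)) * ?near j) summable_on UNIV"
      by (intro summable_conv e Lq_restr c')
    have far_s: "(\<lambda>j. if i \<in> lball x (2 * N) then h (sup_norm (x - j) div 2) * ?far j else 0) summable_on UNIV"
      using summable_conv[OF h2 Lq_restr[OF c']] by (cases "i \<in> lball x (2 * N)") simp_all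
    have D_le: "cmod (?D j) \<le> ?B j" for j
    proof (cases "j \<in> lball x (8 * N)")
      case True
      have d: "\<bar>\<psi> j - \<psi> i\<bar> \<le> 1" "\<bar>\<psi> j - \<psi> i\<bar> \<le> real (sup_norm (i - j)) / real N"
        using cutoff_diff_le[OF N, of x j i] cutoff_nonneg[of N x] cutoff_le_1[of N x]
        by (auto simp: \<psi>_def abs_le_iff) (smt (verit))+
      from e(2)[of "sup_norm (i - j)"] mult_right_mono[OF d(1) profile_nonneg[OF h(1), of "sup_norm (i - j)"]]
        mult_right_mono[OF d(2) profile_nonneg[OF h(1), of "sup_norm (i - j)"]]
      have "\<bar>\<psi> j - \<psi> i\<bar> * h (sup_norm (i - j)) \<le> e (sup_norm (i - j))"
        by linarith
      moreover have "cmod (a i j) * \<bar>\<psi> j - \<psi> i\<bar> \<le> h (sup_norm (i - j)) * \<bar>\<psi> j - \<psi> i\<bar>"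
        by (intro mult_right_mono h) auto
      ultimately have "cmod (a i j) * \<bar>\<psi> j - \<psi> i\<bar> \<le> e (sup_norm (i - j))"
        by (simp add: mult.commute)
      then have "cmod (?D j) \<le> e (sup_norm (i - j)) * c' j"
        unfolding norm_mult c'_def norm_of_real by (intro mult_right_mono) auto
      then show ?thesis
        using True by (simp add: restr_def)
    next
      case False
      have \<psi>j: "\<psi> j = 0"
        unfolding \<psi>_def using False by (intro cutoff_eq_0 N) (auto simp: lball_def)
      show ?thesis
      proof (cases "i \<in> lball x (2 * N)")
        case True
        \<comment> \<open>The 2N by which i may differ from x is less than a quarter of |x - j|, so
          |i - j| is at least half of |x - j|.\<close>
        have "sup_norm (x - j) \<le> 2 * N + sup_norm (i - j)" "8 * N < sup_norm (x - j)"
          using True False sup_norm_triangle_diff[of x j i]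
          by (auto simp: lball_def sup_norm_minus_commute)
        then have "h (sup_norm (i - j)) \<le> h (sup_norm (x - j) div 2)"
          by (intro profile_antimono[OF h(1)]) linarith
        then have "cmod (a i j) * \<bar>\<psi> j - \<psi> i\<bar> \<le> h (sup_norm (x - j) div 2) * 1"
          using cutoff_nonneg[of N x i] cutoff_le_1[of N x i]
          by (intro mult_mono order.trans[OF h(2)] profile_nonneg[OF h(1)]) (auto simp: \<psi>j, simp_all add: \<psi>_def)
        then have "cmod (?D j) \<le> h (sup_norm (x - j) div 2) * c' j"
          unfolding norm_mult c'_def norm_of_real by (intro mult_right_mono) auto
        then show ?thesis
          using True False by (simp add: restr_def)
      next
        case i: False
        have "\<psi> i = 0"
          unfolding \<psi>_def by (intro cutoff_eq_0 N i)
        then show ?thesis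
          using \<psi>j False i by (simp add: restr_def)
      qed
    qed
    have B_s: "?B summable_on UNIV"
      by (intro summable_on_add near_s far_s)
    have D_s: "?D summable_on UNIV"
      by (rule summable_on_dominated[OF B_s D_le])
    have "mat_apply a f i = (\<Sum>\<^sub>\<infinity>j\<in>UNIV. of_real (\<psi> i) * (a i j * c j) + ?D j)"
      unfolding mat_apply_def f_def by (intro infsum_cong) (simp add: algebra_simps)
    also have "\<dots> = of_real (\<psi> i) * mat_apply a c i + (\<Sum>\<^sub>\<infinity>j\<in>UNIV. ?D j)"
      unfolding mat_apply_def infsum_add[OF summable_on_cmult_right[OF summable_mat_apply[OF h c]] D_s]
        infsum_cmult_right' ..
    finally have "cmod (mat_apply a f i) \<le> cmod (of_real (\<psi> i) * mat_apply a c i) + cmod (\<Sum>\<^sub>\<infinity>j\<in>UNIV. ?D j)"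
      by (simp add: norm_triangle_ineq)
    moreover have "cmod (of_real (\<psi> i) * mat_apply a c i) \<le> r1 i"
    proof (cases "i \<in> lball x (2 * N)")
      case True
      then show ?thesis
        by (simp add: r1_def restr_def norm_mult \<psi>_def cutoff_nonneg cutoff_le_1 mult_left_le_one_le)
    next
      case False
      then show ?thesis
        using cutoff_eq_0[OF N False] by (simp add: r1_def restr_def \<psi>_def)
    qed
    moreover have "cmod (\<Sum>\<^sub>\<infinity>j\<in>UNIV. ?D j) \<le> conv e ?near i + r3 i"
    proof -
      have "cmod (\<Sum>\<^sub>\<infinity>j\<in>UNIV. ?D j) \<le> infsum ?B UNIV"
        by (rule norm_infsum_dominated[OF B_s D_le])
      also have "\<dots> = conv e ?near i + r3 i"
        unfolding infsum_add[OF near_s far_s] by (simp add: conv_def r3_def \<Gamma>_def)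
      finally show ?thesis .
    qed
    ultimately show ?thesis
      by linarith
  qed
  have "lqw_norm q w (mat_apply a f) \<le> nrm (\<lambda>i. r1 i + (conv e ?near i + r3 i))"
    unfolding lqw_norm_eq by (rule nrm_mono[OF Lq_add[OF r1 Lq_add[OF r2 r3]] _ pointwise]) auto
  also have "\<dots> \<le> nrm r1 + (nrm (conv e ?near) + nrm r3)"
    by (intro order.trans[OF nrm_triangle] add_mono Lq_add r1 r2 r3 nrm_triangle order.refl)
  also have "nrm (conv e ?near) \<le> opC * mass TYPE('d) e * (dbl 10 powr (1 / q) / vol TYPE('d) N * (\<Sum>y\<in>lball x (9 * N). \<alpha> y)) * b"
  proof -
    have "nrm (conv e ?near) \<le> opC * mass TYPE('d) e * nrm ?near"
      by (intro nrm_conv e Lq_restr c')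
    also have "\<dots> \<le> opC * mass TYPE('d) e * (dbl 10 powr (1 / q) / vol TYPE('d) N * (\<Sum>y\<in>lball x (9 * N). \<alpha> y) * b)"
      using nrm_restr_near[OF c'] opC_nonneg mass_nonneg[OF e(1)]
      by (intro mult_left_mono) (auto simp: \<alpha>_def b_def c'_def[abs_def])
    finally show ?thesis
      by (simp add: mult.assoc)
  qed
  also have "nrm r3 \<le> C powr (1 / q) * dbl 2 powr (1 / q) * conv (\<lambda>n. h (max n N div 4)) \<alpha> x * b"
  proof -
    have "ball_weight x (2 * N) powr (1 / q) \<le> dbl 2 powr (1 / q) * b"
      unfolding b_def by (intro ball_weight_powr_le ball_weight_doubling lball_subset dbl_nonneg) auto
    moreover have "\<Gamma> \<le> C powr (1 / q) * conv (\<lambda>n. h (max n N div 4)) \<alpha> x"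
      using conv_restr_far[OF h(1) c'] by (simp add: \<Gamma>_def \<alpha>_def c'_def[abs_def])
    ultimately have "nrm r3 \<le> (C powr (1 / q) * conv (\<lambda>n. h (max n N div 4)) \<alpha> x) * (dbl 2 powr (1 / q) * b)"
      unfolding nrm_r3 using \<Gamma> b by (intro mult_mono) auto
    then show ?thesis
      by (simp add: mult_ac)
  qed
  finally have Af: "lqw_norm q w (mat_apply a f) \<le> nrm r1
      + (opC * mass TYPE('d) e * (dbl 10 powr (1 / q) / vol TYPE('d) N * (\<Sum>y\<in>lball x (9 * N). \<alpha> y)) * b
      + C powr (1 / q) * dbl 2 powr (1 / q) * conv (\<lambda>n. h (max n N div 4)) \<alpha> x * b)"
    by simp
  \<comment> \<open>The cutoff is 1 on the N-ball, so the norm of f controls the average at x. Every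
    term now carries the factor b, which is divided out at the end.\<close>
  have "\<alpha> x * b = nrm (restr (lball x N) c')"
    by (simp add: b_def \<alpha>_def nrm_restr_lball c'_def[abs_def])
  also have "\<dots> \<le> lqw_norm q w f"
    unfolding lqw_norm_eq
  proof (rule nrm_mono)
    show "restr (lball x N) c' i \<le> cmod (f i)" for i
      by (auto simp: cmod_f restr_def \<psi>_def cutoff_eq_1[OF N] cutoff_nonneg Lq_nonneg[OF c'])
  qed (use f in \<open>auto simp: lqw_iff restr_def Lq_nonneg[OF c']\<close>)
  also have "\<dots> \<le> K * lqw_norm q w (mat_apply a f)"
    by (rule K(2)[OF f])
  also note mult_left_mono[OF Af K(1)]
  finally have "\<alpha> x * b \<le> K * (nrm r1 / b
      + opC * mass TYPE('d) e * (dbl 10 powr (1 / q) / vol TYPE('d) N * (\<Sum>y\<in>lball x (9 * N). \<alpha> y))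
      + C powr (1 / q) * dbl 2 powr (1 / q) * conv (\<lambda>n. h (max n N div 4)) \<alpha> x) * b"
    using b by (simp add: algebra_simps)
  then show ?thesis
    using b by (simp add: b_def r1_def)
qed

text \<open>The convolution inequality \<open>\<alpha> \<le> \<beta> + v * \<alpha>\<close> is solved without a Neumann series: for
  \<open>\<gamma> = u * \<alpha>\<close> the bound \<open>u * u \<le> u/2\<close> gives \<open>\<gamma> \<le> u * \<beta> + \<gamma>/2\<close>, and \<open>\<gamma>\<close> is finite.\<close>

lemma conv_inequality_solve:
  assumes u: "profile TYPE('d) u"
    and uu: "\<And>F z y. finite F \<Longrightarrow>
      (\<Sum>x\<in>F. u (sup_norm (z - x)) * u (sup_norm (x - y :: int ^ 'd))) \<le> u (sup_norm (z - y)) / 2"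
    and \<alpha>: "Lq \<alpha>"
    and S: "finite S" and \<beta>: "\<And>x. 0 \<le> \<beta> x" "\<And>x. x \<notin> S \<Longrightarrow> \<beta> x = 0"
    and le: "\<And>x. \<alpha> x \<le> \<beta> x + conv u \<alpha> x"
  shows "\<alpha> z \<le> \<beta> z + 2 * (\<Sum>x\<in>S. u (sup_norm (z - x)) * \<beta> x)"
proof -
  have nn: "0 \<le> u n" for n
    by (rule profile_nonneg[OF u])
  let ?U = "\<Sum>x\<in>S. u (sup_norm (z - x)) * \<beta> x"
  have "(\<Sum>x\<in>F. u (sup_norm (z - x)) * \<alpha> x) \<le> ?U + conv u \<alpha> z / 2" if F: "finite F" for F
  proof -
    have "(\<Sum>x\<in>F. u (sup_norm (z - x)) * \<alpha> x)
        \<le> (\<Sum>x\<in>F. u (sup_norm (z - x)) * \<beta> x) + (\<Sum>x\<in>F. u (sup_norm (z - x)) * conv u \<alpha> x)"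
      unfolding sum.distrib[symmetric] distrib_left[symmetric] by (intro sum_mono mult_left_mono le nn)
    also have "(\<Sum>x\<in>F. u (sup_norm (z - x)) * \<beta> x) = (\<Sum>x\<in>F \<inter> S. u (sup_norm (z - x)) * \<beta> x)"
      using F \<beta>(2) by (intro sum.mono_neutral_right) auto
    also have "\<dots> \<le> ?U"
      using S by (intro sum_mono2) (auto simp: nn \<beta>)
    also have "(\<Sum>x\<in>F. u (sup_norm (z - x)) * conv u \<alpha> x) \<le> conv u \<alpha> z / 2"
    proof -
      have 1: "((\<lambda>y. \<Sum>x\<in>F. u (sup_norm (z - x)) * (u (sup_norm (x - y)) * \<alpha> y)) has_sum
          (\<Sum>x\<in>F. u (sup_norm (z - x)) * conv u \<alpha> x)) UNIV"
        unfolding conv_def by (intro has_sum_sum F has_sum_cmult_right has_sum_infsum summable_conv u \<alpha>)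
      have 2: "((\<lambda>y. 1 / 2 * (u (sup_norm (z - y)) * \<alpha> y)) has_sum (1 / 2 * conv u \<alpha> z)) UNIV"
        unfolding conv_def by (intro has_sum_cmult_right has_sum_infsum summable_conv u \<alpha>)
      have "(\<Sum>x\<in>F. u (sup_norm (z - x)) * conv u \<alpha> x) \<le> 1 / 2 * conv u \<alpha> z"
      proof (rule has_sum_mono[OF 1 2])
        fix y
        have "(\<Sum>x\<in>F. u (sup_norm (z - x)) * (u (sup_norm (x - y)) * \<alpha> y))
            = (\<Sum>x\<in>F. u (sup_norm (z - x)) * u (sup_norm (x - y))) * \<alpha> y"
          by (simp add: sum_distrib_right mult.assoc)
        also have "\<dots> \<le> u (sup_norm (z - y)) / 2 * \<alpha> y"
          by (intro mult_right_mono uu F Lq_nonneg[OF \<alpha>])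
        finally show "(\<Sum>x\<in>F. u (sup_norm (z - x)) * (u (sup_norm (x - y)) * \<alpha> y))
            \<le> 1 / 2 * (u (sup_norm (z - y)) * \<alpha> y)"
          by simp
      qed
      then show ?thesis
        by simp
    qed
    finally show ?thesis
      by simp
  qed
  \<comment> \<open>The uniform bound on partial sums passes to the convergent series, and half of
    its real value can be subtracted.\<close>
  then have "conv u \<alpha> z \<le> ?U + conv u \<alpha> z / 2"
    unfolding conv_def[of u \<alpha> z]
    by (intro infsum_le_finite_sums summable_conv u \<alpha>)
  then have "conv u \<alpha> z \<le> 2 * ?U"
    by simp
  with le[of z] show ?thesis
    by linarith
qed

section \<open>Decay of the columns of the inverse\<close>

text \<open>N is chosen so large that the commutator terms form a profile v of mass at most t/8. Its
  doubling envelope meets the hypotheses of \<open>conv_inequality_solve\<close>, and an average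
  over an N-ball controls the value at its centre. All constants are fixed before c and m, so one g
  serves every column.\<close>

lemma column_decay:
  assumes h: "profile TYPE('d) h" "\<And>i j. cmod (a i j) \<le> h (sup_norm (i - j))"
    and K: "0 \<le> K" "\<And>f. f \<in> lqw q w \<Longrightarrow> lqw_norm q w f \<le> K * lqw_norm q w (mat_apply a f)"
  obtains g where "profile TYPE('d) g"
    "\<And>c m i. c \<in> lqw q w \<Longrightarrow> mat_apply a c = unit_seq m \<Longrightarrow> cmod (c i) \<le> g (sup_norm (i - m))"
proof -
  define t :: real where "t = 1 / (2 * 3 ^ CARD('d))"
  have t: "0 < t"
    by (simp add: t_def)
  \<comment> \<open>The N-independent parts of the near and far coefficients. The 9^d bounds the
    growth of volume from radius N to 9N; the remaining vol N cancels the one in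
    \<open>k1\<close>.\<close>
  define \<kappa>1 where "\<kappa>1 = K * (opC * dbl 10 powr (1 / q) * 9 ^ CARD('d))"
  define \<kappa>2 where "\<kappa>2 = K * (C powr (1 / q) * dbl 2 powr (1 / q))"
  have \<kappa>: "0 \<le> \<kappa>1" "0 \<le> \<kappa>2"
    using K(1) opC_nonneg by (simp_all add: \<kappa>1_def \<kappa>2_def)
  define \<delta> where "\<delta> = t / (8 * (\<kappa>1 + \<kappa>2 + 1))"
  have \<delta>: "0 < \<delta>"
    using t \<kappa> by (simp add: \<delta>_def)
  have \<delta>_le: "(\<kappa>1 + \<kappa>2) * \<delta> \<le> t / 8"
    using t \<kappa> by (simp add: \<delta>_def field_simps)
  obtain R1 where R1: "mass TYPE('d) (\<lambda>n. h (max n R1)) \<le> \<delta> / 2"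
    using profile_tail[OF h(1), of "\<delta> / 2"] \<delta> by (metis half_gt_zero order.refl)
  have h4: "profile TYPE('d) (\<lambda>n. h (n div 4))"
    using profile_dyadic[OF h(1), of 2] by simp
  obtain R2 where R2: "\<And>r. R2 \<le> r \<Longrightarrow> mass TYPE('d) (\<lambda>n. h (max n r div 4)) \<le> \<delta>"
    using profile_tail[OF h4 \<delta>] by metis
  obtain N0 :: nat where N0: "2 * real R1 * mass TYPE('d) h / \<delta> < real N0"
    using reals_Archimedean2 by blast
  define N where "N = max 1 (max N0 R2)"
  have N: "1 \<le> N" "R2 \<le> N" "0 < real N" and "real N0 \<le> real N"
    by (auto simp: N_def)
  with N0 have "2 * real R1 * mass TYPE('d) h / \<delta> \<le> real N"
    by linarith
  then have RN: "real R1 / real N * mass TYPE('d) h \<le> \<delta> / 2"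
    using N \<delta> by (simp add: field_simps)
  \<comment> \<open>Entries closer than R1 gain R1 / N from the Lipschitz bound, the others are
    covered by the flattened tail. R1 is fixed first and N after it, so each part has mass at most
    \<delta> / 2.\<close>
  define e where "e n = real R1 / real N * h n + h (max n R1)" for n
  have e: "profile TYPE('d) e" "mass TYPE('d) e \<le> \<delta>"
  proof -
    show "profile TYPE('d) e"
      unfolding e_def by (intro profile_add profile_cmult profile_max h) auto
    have "mass TYPE('d) e = real R1 / real N * mass TYPE('d) h + mass TYPE('d) (\<lambda>n. h (max n R1))"
      unfolding e_def
      by (subst mass_add[OF profile_cmult[OF h(1)] profile_max[OF h(1)]]) (simp_all only: mass_cmult, simp)
    then show "mass TYPE('d) e \<le> \<delta>"
      using RN R1 by linarith
  qed
  have e_le: "h n \<le> e n \<or> real n / real N * h n \<le> e n" for n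
  proof (cases "R1 \<le> n")
    case True
    then have "h n \<le> e n"
      using profile_nonneg[OF h(1), of n] by (simp add: e_def max_def)
    then show ?thesis ..
  next
    case False
    then have "real n / real N * h n \<le> real R1 / real N * h n"
      by (intro mult_right_mono divide_right_mono profile_nonneg[OF h(1)]) auto
    also have "\<dots> \<le> e n"
      using profile_nonneg[OF h(1)] by (simp add: e_def)
    finally show ?thesis ..
  qed
  define k1 where "k1 = K * (opC * mass TYPE('d) e * (dbl 10 powr (1 / q) / vol TYPE('d) N))"
  have k1: "0 \<le> k1"
    unfolding k1_def using vol_pos[of "TYPE('d)" N]
    by (intro mult_nonneg_nonneg K(1) opC_nonneg mass_nonneg[OF e(1)] divide_nonneg_pos) auto
  \<comment> \<open>The sum over the 9N-ball is a convolution with an indicator, so near and far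
    terms merge into one decreasing profile.\<close>
  define v where "v n = k1 * (if n \<le> 9 * N then 1 else 0) + \<kappa>2 * h (max n N div 4)" for n
  have h4N: "profile TYPE('d) (\<lambda>n. h (max n N div 4))"
    by (rule profile_max[OF h4])
  have ind: "profile TYPE('d) (\<lambda>n. if n \<le> R then 1 else 0)" for R
    by (rule profile_indicator)
  have v: "profile TYPE('d) v"
    unfolding v_def by (intro profile_add profile_cmult ind h4N k1 \<kappa>)
  have mass_v: "mass TYPE('d) v \<le> t / 8"
  proof -
    have "mass TYPE('d) v = k1 * mass TYPE('d) (\<lambda>n. if n \<le> 9 * N then 1 else 0) + \<kappa>2 * mass TYPE('d) (\<lambda>n. h (max n N div 4))"
      unfolding v_def
      by (subst mass_add[OF profile_cmult[OF ind k1] profile_cmult[OF h4N \<kappa>(2)]]) (simp only: mass_cmult)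
    also have "\<dots> \<le> k1 * (9 ^ CARD('d) * vol TYPE('d) N) + \<kappa>2 * \<delta>"
    proof (intro add_mono mult_left_mono k1 \<kappa> R2 N)
      have "mass TYPE('d) (\<lambda>n. if n \<le> 9 * N then 1 else 0) \<le> vol TYPE('d) (9 * N)"
        using mass_indicator[of "9 * N", where 'd = 'd] by (simp add: vol_def add.commute)
      also have "\<dots> \<le> 9 ^ CARD('d) * vol TYPE('d) N"
        using vol_mult[of "9 * N" 9 N, where 'd = 'd] by simp
      finally show "mass TYPE('d) (\<lambda>n. if n \<le> 9 * N then 1 else 0) \<le> 9 ^ CARD('d) * vol TYPE('d) N" .
    qed
    also have "k1 * (9 ^ CARD('d) * vol TYPE('d) N) = \<kappa>1 * mass TYPE('d) e"
      by (simp add: k1_def \<kappa>1_def)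
    also have "\<dots> \<le> \<kappa>1 * \<delta>"
      by (intro mult_left_mono e \<kappa>)
    finally show ?thesis
      using \<delta>_le by (simp add: distrib_right)
  qed
  obtain u where u: "profile TYPE('d) u" "\<And>n. v n \<le> u n" "\<And>n. u (n div 2) \<le> 1 / t * u n"
    and mass_u: "mass TYPE('d) u \<le> 2 * mass TYPE('d) v"
    using doubling_envelope[OF v] unfolding t_def by (metis divide_inverse_commute inverse_eq_divide)
  have u_nn: "0 \<le> u n" for n
    by (rule profile_nonneg[OF u(1)])
  have uu: "(\<Sum>x\<in>F. u (sup_norm (z - x)) * u (sup_norm (x - y))) \<le> u (sup_norm (z - y)) / 2"
    if "finite F" for F and y z :: "int ^ 'd"
  proof -
    \<comment> \<open>The mass of u is at most twice t/8, which is where the 8 in \<delta> comes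
      from.\<close>
    have "2 * (1 / t) * mass TYPE('d) u \<le> 1 / 2"
      using mass_u mass_v t by (simp add: field_simps)
    then have "2 * (1 / t) * mass TYPE('d) u * u (sup_norm (z - y)) \<le> 1 / 2 * u (sup_norm (z - y))"
      by (intro mult_right_mono u_nn)
    with doubling_convolution[OF u(1,3) that, of z y] show ?thesis
      by linarith
  qed
  define b0 where "b0 = K * dbl 2 powr (1 / q)"
  define d0 where "d0 = dbl (2 * N + 1) powr (1 / q)"
  define V where "V = vol TYPE('d) (2 * N)"
  have nn: "0 \<le> b0" "0 \<le> d0" "0 \<le> V"
    using K(1) by (simp_all add: b0_def d0_def V_def less_imp_le)
  \<comment> \<open>For |i - m| <= 4N every value of u is bounded by u 0. Beyond that, |i - y| is at
    least half of |i - m| for y in the 2N-ball at m, and doubling costs 1/t. V counts that ball; d0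
    turns an average into a pointwise value.\<close>
  define g where "g n = d0 * (b0 + 2 * V * b0 * u 0) * (if n \<le> 4 * N then 1 else 0) + d0 * (2 * V * b0 / t) * u n" for n
  have "profile TYPE('d) g"
    unfolding g_def using nn t u_nn by (intro profile_add profile_cmult ind u(1)) auto
  moreover have "cmod (c i) \<le> g (sup_norm (i - m))"
    if c: "c \<in> lqw q w" and Ac: "mat_apply a c = unit_seq m" for c m i
  proof -
    define \<alpha> where "\<alpha> = local_avg N (\<lambda>i. cmod (c i))"
    have \<alpha>: "Lq \<alpha>"
      unfolding \<alpha>_def using c by (intro Lq_local_avg) (simp add: lqw_iff)
    define \<beta> where "\<beta> x = (if x \<in> lball m (2 * N) then b0 else 0)" for x
    have rhs: "K * (nrm (restr (lball x (2 * N)) (\<lambda>i. cmod (mat_apply a c i))) / ball_weight x N powr (1 / q)) \<le> \<beta> x" for x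
    proof -
      let ?f = "restr (lball x (2 * N)) (\<lambda>i. cmod (mat_apply a c i))"
      have "nrm ?f = (\<Sum>i\<in>{m}. ?f i powr q * w i) powr (1 / q)"
        by (intro nrm_finite_support) (auto simp: restr_def Ac unit_seq_def)
      also have "\<dots> = (if x \<in> lball m (2 * N) then w m powr (1 / q) else 0)"
        by (simp add: restr_def Ac unit_seq_def lball_sym)
      finally have nrm_f: "nrm ?f = (if x \<in> lball m (2 * N) then w m powr (1 / q) else 0)" .
      show ?thesis
      proof (cases "x \<in> lball m (2 * N)")
        case True
        then have "ball_weight m 0 \<le> ball_weight x (2 * N)"
          by (intro sum_mono2) (auto simp: w_nonneg lball_0 lball_sym)
        also have "\<dots> \<le> dbl 2 * ball_weight x N"
          by (intro ball_weight_doubling lball_subset) auto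
        finally have "ball_weight m 0 powr (1 / q) \<le> dbl 2 powr (1 / q) * ball_weight x N powr (1 / q)"
          by (intro ball_weight_powr_le dbl_nonneg)
        then have "w m powr (1 / q) / ball_weight x N powr (1 / q) \<le> dbl 2 powr (1 / q)"
          using ball_weight_pos[of x N] by (simp add: divide_le_eq lball_0)
        from mult_left_mono[OF this K(1)] show ?thesis
          using True by (simp add: nrm_f \<beta>_def b0_def)
      next
        case False
        then show ?thesis
          by (simp add: nrm_f \<beta>_def)
      qed
    qed
    have le: "\<alpha> x \<le> \<beta> x + conv u \<alpha> x" for x
    proof -
      have s1: "(\<lambda>y. k1 * ((if sup_norm (x - y) \<le> 9 * N then 1 else 0) * \<alpha> y)) summable_on UNIV"
        by (intro summable_on_cmult_right summable_conv[OF ind \<alpha>])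
      have s2: "(\<lambda>y. \<kappa>2 * (h (max (sup_norm (x - y)) N div 4) * \<alpha> y)) summable_on UNIV"
        by (intro summable_on_cmult_right summable_conv[OF h4N \<alpha>])
      have "conv v \<alpha> x = k1 * conv (\<lambda>n. if n \<le> 9 * N then 1 else 0) \<alpha> x + \<kappa>2 * conv (\<lambda>n. h (max n N div 4)) \<alpha> x"
        unfolding conv_def infsum_cmult_right'[symmetric] infsum_add[OF s1 s2, symmetric]
        by (simp add: v_def algebra_simps)
      also have "conv (\<lambda>n. if n \<le> 9 * N then 1 else 0) \<alpha> x = (\<Sum>y\<in>lball x (9 * N). \<alpha> y)"
        by (rule conv_indicator)
      finally have conv_v: "conv v \<alpha> x = k1 * (\<Sum>y\<in>lball x (9 * N). \<alpha> y) + \<kappa>2 * conv (\<lambda>n. h (max n N div 4)) \<alpha> x" .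
      have "\<alpha> x \<le> \<beta> x + conv v \<alpha> x"
        using commutator_local_avg_le[OF h N(1) e(1) e_le K c, of x] rhs[of x]
        unfolding \<alpha>_def[symmetric] conv_v k1_def \<kappa>2_def by (simp add: algebra_simps)
      also have "conv v \<alpha> x \<le> conv u \<alpha> x"
        unfolding conv_def
        by (intro infsum_mono summable_conv v u(1) \<alpha> mult_right_mono u(2) Lq_nonneg[OF \<alpha>])
      finally show ?thesis
        by simp
    qed
    have "\<alpha> i \<le> \<beta> i + 2 * (\<Sum>y\<in>lball m (2 * N). u (sup_norm (i - y)) * \<beta> y)"
      by (rule conv_inequality_solve[OF u(1) uu \<alpha> finite_lball _ _ le]) (auto simp: \<beta>_def nn)
    also have "(\<Sum>y\<in>lball m (2 * N). u (sup_norm (i - y)) * \<beta> y)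
        \<le> (\<Sum>y\<in>lball m (2 * N). (if sup_norm (i - m) \<le> 4 * N then u 0 else 1 / t * u (sup_norm (i - m))) * b0)"
    proof (rule sum_mono)
      fix y assume y: "y \<in> lball m (2 * N)"
      have "u (sup_norm (i - y)) \<le> (if sup_norm (i - m) \<le> 4 * N then u 0 else 1 / t * u (sup_norm (i - m)))"
      proof (cases "sup_norm (i - m) \<le> 4 * N")
        case True
        then show ?thesis
          using profile_antimono[OF u(1), of 0] by simp
      next
        case False
        then have "sup_norm (i - m) div 2 \<le> sup_norm (i - y)"
          using y sup_norm_triangle_diff[of i m y] by (simp add: lball_def)
        then have "u (sup_norm (i - y)) \<le> u (sup_norm (i - m) div 2)"
          by (rule profile_antimono[OF u(1)])
        with u(3)[of "sup_norm (i - m)"] False show ?thesis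
          by simp
      qed
      from mult_right_mono[OF this nn(1)] show "u (sup_norm (i - y)) * \<beta> y \<le> (if sup_norm (i - m) \<le> 4 * N then u 0 else 1 / t * u (sup_norm (i - m))) * b0"
        using y by (simp add: \<beta>_def)
    qed
    also have "\<dots> = V * (if sup_norm (i - m) \<le> 4 * N then u 0 else 1 / t * u (sup_norm (i - m))) * b0"
      by (simp add: V_def card_lball vol_def)
    also have "\<beta> i \<le> b0 * (if sup_norm (i - m) \<le> 4 * N then 1 else 0)"
      using nn by (auto simp: \<beta>_def lball_def)
    finally have "\<alpha> i \<le> b0 * (if sup_norm (i - m) \<le> 4 * N then 1 else 0)
        + 2 * (V * (if sup_norm (i - m) \<le> 4 * N then u 0 else 1 / t * u (sup_norm (i - m))) * b0)"
      by simp
    also have "d0 * \<dots> \<le> g (sup_norm (i - m))"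
      using nn t u_nn by (auto simp: g_def algebra_simps)
    finally have "d0 * \<alpha> i \<le> g (sup_norm (i - m))"
      using nn by (simp add: mult_left_mono)
    moreover have "cmod (c i) \<le> d0 * \<alpha> i"
    proof -
      \<comment> \<open>The ball of radius 0 is its centre, so doubling with side ratio 2N + 1
        compares the weight of the N-ball with the single weight w i.\<close>
      have "ball_weight i N \<le> dbl (2 * N + 1) * ball_weight i 0"
        by (intro ball_weight_doubling lball_subset) auto
      then have bw: "ball_weight i N powr (1 / q) \<le> d0 * w i powr (1 / q)"
        using ball_weight_powr_le[of i N "dbl (2 * N + 1)" i 0] dbl_nonneg by (simp add: d0_def lball_0)
      have "cmod (c i) * w i powr (1 / q) = local_avg 0 (\<lambda>i. cmod (c i)) i * ball_weight i 0 powr (1 / q)"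
        using q w_pos[of i] by (simp add: local_avg_def lball_0 powr_powr)
      also have "\<dots> = nrm (restr (lball i 0) (\<lambda>i. cmod (c i)))"
        by (simp add: nrm_restr_lball)
      also have "\<dots> \<le> nrm (restr (lball i N) (\<lambda>i. cmod (c i)))"
        using c by (intro nrm_mono[OF Lq_restr]) (auto simp: restr_def lball_def lqw_iff)
      also have "\<dots> = \<alpha> i * ball_weight i N powr (1 / q)"
        by (simp add: nrm_restr_lball \<alpha>_def)
      also have "\<dots> \<le> \<alpha> i * (d0 * w i powr (1 / q))"
        by (intro mult_left_mono bw Lq_nonneg[OF \<alpha>])
      finally show ?thesis
        using w_pos[of i] by (simp add: mult_ac)
    qed
    ultimately show ?thesis
      by linarith
  qed
  ultimately show ?thesis ..
qed

end

subsection \<open>The operator algebra\<close>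

lemma B_matrices_uminus:
  "a \<in> B_matrices \<Longrightarrow> (\<lambda>i j. - a i j :: complex) \<in> (B_matrices :: (int ^ 'd::finite \<Rightarrow> int ^ 'd \<Rightarrow> complex) set)"
  by (simp add: B_matrices_iff)

lemma B_matrices_cmult:
  assumes "a \<in> B_matrices"
  shows "(\<lambda>i j :: int ^ 'd::finite. z * a i j) \<in> B_matrices"
proof -
  obtain h where h: "profile TYPE('d) h" "\<And>i j. cmod (a i j) \<le> h (sup_norm (i - j))"
    using assms by (auto simp: B_matrices_iff)
  have "cmod (z * a i j) \<le> cmod z * h (sup_norm (i - j))" for i j
    unfolding norm_mult by (intro mult_left_mono h) auto
  then show ?thesis
    using profile_cmult[OF h(1), of "cmod z"] by (auto simp: B_matrices_iff)
qed

lemma B_matrices_add: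
  assumes "a \<in> B_matrices" "b \<in> B_matrices"
  shows "(\<lambda>i j :: int ^ 'd::finite. a i j + b i j) \<in> B_matrices"
proof -
  obtain h where h: "profile TYPE('d) h" "\<And>i j. cmod (a i j) \<le> h (sup_norm (i - j))"
    using B_matricesE[OF assms(1)] by metis
  obtain g where g: "profile TYPE('d) g" "\<And>i j. cmod (b i j) \<le> g (sup_norm (i - j))"
    using B_matricesE[OF assms(2)] by metis
  have "cmod (a i j + b i j) \<le> h (sup_norm (i - j)) + g (sup_norm (i - j))" for i j
    by (intro order.trans[OF norm_triangle_ineq] add_mono h g)
  then show ?thesis
    using profile_add[OF h(1) g(1)] by (auto simp: B_matrices_iff)
qed

lemma B_matrices_id: "(\<lambda>i j :: int ^ 'd::finite. if i = j then 1 else 0 :: complex) \<in> B_matrices"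
proof -
  have "profile TYPE('d) (\<lambda>n. if n \<le> 0 then 1 else 0)"
    by (rule profile_indicator)
  then show ?thesis
    by (auto simp: B_matrices_iff intro!: exI[of _ "\<lambda>n. if n \<le> 0 then 1 else (0::real)"])
qed

lemma mat_apply_id: "mat_apply (\<lambda>i j. if i = j then 1 else 0) c = c"
proof
  fix i
  have "mat_apply (\<lambda>i j. if i = j then 1 else 0) c i = infsum c {i}"
    unfolding mat_apply_def by (intro infsum_cong_neutral) auto
  then show "mat_apply (\<lambda>i j. if i = j then 1 else 0) c i = c i"
    by simp
qed

lemma mat_apply_unit_seq: "mat_apply a (unit_seq m) i = a i m"
proof -
  have "mat_apply a (unit_seq m) i = infsum (a i) {m}"
    unfolding mat_apply_def by (intro infsum_cong_neutral) (auto simp: unit_seq_def)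
  then show ?thesis
    by simp
qed

context muckenhoupt
begin

lemma unit_seq_in_lqw: "unit_seq m \<in> lqw q w"
  unfolding lqw_iff by (rule Lq_finite_support[of "{m}"]) (auto simp: unit_seq_def)

lemma lqw_add: "c \<in> lqw q w \<Longrightarrow> e \<in> lqw q w \<Longrightarrow> (\<lambda>i. c i + e i) \<in> lqw q w"
  unfolding lqw_iff by (rule Lq_mono[OF Lq_add[of "\<lambda>i. cmod (c i)" "\<lambda>i. cmod (e i)"]]) (auto intro: norm_triangle_ineq)

lemma lqw_cmult: "c \<in> lqw q w \<Longrightarrow> (\<lambda>i. z * c i) \<in> lqw q w"
  unfolding lqw_iff norm_mult by (rule Lq_cmult) auto

lemma B_mat_summable: "a \<in> B_matrices \<Longrightarrow> c \<in> lqw q w \<Longrightarrow> (\<lambda>j. a i j * c j) summable_on UNIV"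
  and B_mat_apply_in_lqw: "a \<in> B_matrices \<Longrightarrow> c \<in> lqw q w \<Longrightarrow> mat_apply a c \<in> lqw q w"
  by (metis B_matricesE summable_mat_apply, metis B_matricesE mat_apply_in_lqw)

lemma mat_apply_lin_vec:
  assumes a: "a \<in> B_matrices" and c: "c \<in> lqw q w" and e: "e \<in> lqw q w"
  shows "mat_apply a (\<lambda>i. c i + e i) = (\<lambda>i. mat_apply a c i + mat_apply a e i)"
  unfolding mat_apply_def distrib_left infsum_add[OF B_mat_summable[OF a c] B_mat_summable[OF a e]] ..

lemma mat_apply_scale_vec: "mat_apply a (\<lambda>i. z * c i) = (\<lambda>i. z * mat_apply a c i)"
  unfolding mat_apply_def mult.left_commute[of _ z] infsum_cmult_right' ..

lemma mat_apply_add: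
  assumes a: "a \<in> B_matrices" and b: "b \<in> B_matrices" and c: "c \<in> lqw q w"
  shows "mat_apply (\<lambda>i j. a i j + b i j) c = (\<lambda>i. mat_apply a c i + mat_apply b c i)"
  unfolding mat_apply_def distrib_right infsum_add[OF B_mat_summable[OF a c] B_mat_summable[OF b c]] ..

lemma mat_apply_scale: "mat_apply (\<lambda>i j. z * a i j) c = (\<lambda>i. z * mat_apply a c i)"
  unfolding mat_apply_def mult.assoc infsum_cmult_right' ..

lemma mat_apply_uminus: "mat_apply (\<lambda>i j. - a i j) c = (\<lambda>i. - mat_apply a c i)"
  unfolding mat_apply_def mult_minus_left infsum_uminus ..

lemma mat_operator_bounded:
  assumes a: "a \<in> B_matrices"
  shows "mat_operator q w a \<in> bounded_linear_on_lqw q w"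
proof -
  obtain h where h: "profile TYPE('d) h" "\<And>i j. cmod (a i j) \<le> h (sup_norm (i - j))"
    using B_matricesE[OF a] by metis
  have "\<exists>K. \<forall>c\<in>lqw q w. lqw_norm q w (mat_operator q w a c) \<le> K * lqw_norm q w c"
    using lqw_norm_mat_apply_le[OF h] by (auto simp: mat_operator_def)
  then show ?thesis
    using a by (auto simp: bounded_linear_on_lqw_def mat_operator_def B_mat_apply_in_lqw lqw_add lqw_cmult
        mat_apply_lin_vec mat_apply_scale_vec)
qed

abbreviation (input) L where "L \<equiv> lqw_operators q w"

lemma mat_operator_apply: "c \<in> lqw q w \<Longrightarrow> mat_operator q w a c = mat_apply a c"
  by (simp add: mat_operator_def)

lemma inj_on_mat_operator: "inj_on (mat_operator q w) B_matrices"
proof (rule inj_onI, intro ext)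
  fix a b i m assume "mat_operator q w a = mat_operator q w b"
  then have "mat_apply a (unit_seq m) = mat_apply b (unit_seq m)"
    using mat_operator_apply[OF unit_seq_in_lqw] by metis
  then show "a i m = b i m"
    by (metis mat_apply_unit_seq)
qed

text \<open>Read off the description in \<open>m_inv_def\<close>: the sum condition determines y on
  \<open>lqw q w\<close>, and extensionality determines it elsewhere.\<close>

lemma add_inv_mat_operator:
  assumes a: "a \<in> B_matrices"
  shows "inv\<^bsub>add_monoid L\<^esub> (mat_operator q w a) = mat_operator q w (\<lambda>i j. - a i j)"
  unfolding m_inv_def
proof (rule the_equality)
  show "mat_operator q w (\<lambda>i j. - a i j) \<in> carrier (add_monoid L) \<and>
      mat_operator q w a \<otimes>\<^bsub>add_monoid L\<^esub> mat_operator q w (\<lambda>i j. - a i j) = \<one>\<^bsub>add_monoid L\<^esub> \<and>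
      mat_operator q w (\<lambda>i j. - a i j) \<otimes>\<^bsub>add_monoid L\<^esub> mat_operator q w a = \<one>\<^bsub>add_monoid L\<^esub>"
    using mat_operator_bounded[OF B_matrices_uminus[OF a]]
    by (auto simp: lqw_operators_def mat_operator_def mat_apply_uminus)
next
  fix y assume y: "y \<in> carrier (add_monoid L) \<and> mat_operator q w a \<otimes>\<^bsub>add_monoid L\<^esub> y = \<one>\<^bsub>add_monoid L\<^esub> \<and>
      y \<otimes>\<^bsub>add_monoid L\<^esub> mat_operator q w a = \<one>\<^bsub>add_monoid L\<^esub>"
  then have y_ext: "y \<in> extensional (lqw q w)"
    by (auto simp: lqw_operators_def bounded_linear_on_lqw_def PiE_def)
  from y have sum0: "(\<lambda>c\<in>lqw q w. \<lambda>i. mat_operator q w a c i + y c i) = (\<lambda>c\<in>lqw q w. \<lambda>i. 0)"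
    by (simp add: lqw_operators_def)
  have "y c = (\<lambda>i. - mat_apply a c i)" if "c \<in> lqw q w" for c
    using fun_cong[OF sum0, of c] that by (auto simp: mat_operator_def fun_eq_iff add_eq_0_iff)
  then show "y = mat_operator q w (\<lambda>i j. - a i j)"
    by (intro extensionalityI[OF y_ext]) (auto simp: mat_operator_def mat_apply_uminus)
qed

lemma unital_subalgebra_B: "unital_subalgebra (mat_operator q w ` B_matrices) L"
proof -
  let ?H = "mat_operator q w ` B_matrices"
  have carrier: "?H \<subseteq> carrier L"
    using mat_operator_bounded by (auto simp: lqw_operators_def)
  have add: "mat_operator q w a \<oplus>\<^bsub>L\<^esub> mat_operator q w b \<in> ?H"
    if "a \<in> B_matrices" "b \<in> B_matrices" for a b
    by (rule image_eqI[OF _ B_matrices_add[OF that]])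
       (auto simp: lqw_operators_def mat_operator_def mat_apply_add[OF that])
  have mult: "mat_operator q w a \<otimes>\<^bsub>L\<^esub> mat_operator q w b \<in> ?H"
    if "a \<in> B_matrices" "b \<in> B_matrices" for a b
    by (rule image_eqI[OF _ mat_mult_in_B_matrices[OF that]])
       (auto simp: lqw_operators_def mat_operator_def mat_apply_mat_mult[OF that] B_mat_apply_in_lqw[OF that(2)])
  have one: "\<one>\<^bsub>L\<^esub> \<in> ?H"
    by (rule image_eqI[OF _ B_matrices_id]) (simp add: lqw_operators_def mat_operator_def mat_apply_id)
  have smult: "z \<odot>\<^bsub>L\<^esub> mat_operator q w a \<in> ?H" if "a \<in> B_matrices" for z a
    by (rule image_eqI[OF _ B_matrices_cmult[OF that]])
       (auto simp: lqw_operators_def mat_operator_def mat_apply_scale)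
  have zero: "\<zero>\<^bsub>L\<^esub> \<in> ?H"
    by (rule image_eqI[OF _ B_matrices_cmult[OF B_matrices_id, of 0]])
       (auto simp: lqw_operators_def mat_operator_def mat_apply_def)
  have uminus: "inv\<^bsub>add_monoid L\<^esub> mat_operator q w a \<in> ?H" if "a \<in> B_matrices" for a
    using B_matrices_uminus[OF that] by (simp add: add_inv_mat_operator[OF that])
  have "subgroup ?H (add_monoid L)"
    using carrier add zero uminus by (intro subgroup.intro) auto
  moreover have "submonoid ?H L"
    using carrier mult one by (intro submonoid.intro) auto
  ultimately show ?thesis
    using smult by (auto simp: unital_subalgebra_def subring_def)
qed

text \<open>Column m of the candidate b is T applied to the unit sequence at m, and
  \<open>column_decay\<close> puts b in the class.\<close>

lemma inverse_closed_B: "inverse_closed_subalgebra (mat_operator q w ` B_matrices) L"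
  unfolding inverse_closed_subalgebra_def
proof (intro conjI unital_subalgebra_B ballI impI)
  fix x assume "x \<in> mat_operator q w ` B_matrices" and unit: "x \<in> Units L"
  then obtain a where a: "a \<in> B_matrices" and x: "x = mat_operator q w a"
    by auto
  obtain h where h: "profile TYPE('d) h" "\<And>i j. cmod (a i j) \<le> h (sup_norm (i - j))"
    using B_matricesE[OF a] by metis
  obtain T where T: "T \<in> bounded_linear_on_lqw q w" "T \<otimes>\<^bsub>L\<^esub> x = \<one>\<^bsub>L\<^esub>" "x \<otimes>\<^bsub>L\<^esub> T = \<one>\<^bsub>L\<^esub>"
    using unit by (auto simp: Units_def lqw_operators_def)
  have T_in: "T c \<in> lqw q w" if "c \<in> lqw q w" for c
    using T(1) that by (auto simp: bounded_linear_on_lqw_def)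
  have TA: "T (mat_apply a c) = c" and AT: "mat_apply a (T c) = c" if "c \<in> lqw q w" for c
    using fun_cong[OF T(2), of c] fun_cong[OF T(3), of c] that T_in[OF that]
    by (auto simp: lqw_operators_def x mat_operator_def)
  obtain K0 where K0: "\<And>c. c \<in> lqw q w \<Longrightarrow> lqw_norm q w (T c) \<le> K0 * lqw_norm q w c"
    using T(1) unfolding bounded_linear_on_lqw_def by blast
  define K where "K = max K0 0"
  have K: "lqw_norm q w c \<le> K * lqw_norm q w (mat_apply a c)" if "c \<in> lqw q w" for c
  proof -
    have "lqw_norm q w c \<le> K0 * lqw_norm q w (mat_apply a c)"
      using K0[OF mat_apply_in_lqw[OF h that]] by (simp add: TA[OF that])
    also have "\<dots> \<le> K * lqw_norm q w (mat_apply a c)"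
      by (intro mult_right_mono) (auto simp: K_def lqw_norm_eq nrm_nonneg)
    finally show ?thesis .
  qed
  obtain g where g: "profile TYPE('d) g"
    "\<And>c m i. c \<in> lqw q w \<Longrightarrow> mat_apply a c = unit_seq m \<Longrightarrow> cmod (c i) \<le> g (sup_norm (i - m))"
    using column_decay[OF h _ K] by (auto simp: K_def)
  define b where "b i m = T (unit_seq m) i" for i m
  have b: "b \<in> B_matrices"
    unfolding B_matrices_iff b_def using g T_in AT unit_seq_in_lqw by blast
  have "mat_mult a b i m = (if i = m then 1 else 0)" for i m
    using fun_cong[OF AT[OF unit_seq_in_lqw], of m i]
    by (simp add: mat_mult_def mat_apply_def b_def unit_seq_def)
  then have ab: "mat_mult a b = (\<lambda>i j. if i = j then 1 else 0)"
    by (intro ext)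
  \<comment> \<open>That T is given by b follows without approximation by finite sequences: A (b c)
    = c by associativity, and T undoes A.\<close>
  have T_b: "T c = mat_apply b c" if c: "c \<in> lqw q w" for c
  proof -
    have "mat_apply a (mat_apply b c) = c"
      unfolding mat_apply_mat_mult[OF a b c, symmetric] ab by (rule mat_apply_id)
    then show ?thesis
      using TA[OF B_mat_apply_in_lqw[OF b c]] by simp
  qed
  have "T = mat_operator q w b"
    using T(1) by (intro extensionalityI[of _ "lqw q w"])
      (auto simp: bounded_linear_on_lqw_def PiE_def mat_operator_def T_b)
  moreover have "inv\<^bsub>L\<^esub> x = T"
    unfolding m_inv_def
  proof (rule the_equality)
    show "T \<in> carrier L \<and> x \<otimes>\<^bsub>L\<^esub> T = \<one>\<^bsub>L\<^esub> \<and> T \<otimes>\<^bsub>L\<^esub> x = \<one>\<^bsub>L\<^esub>"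
      using T by (simp add: lqw_operators_def)
  next
    fix S assume S: "S \<in> carrier L \<and> x \<otimes>\<^bsub>L\<^esub> S = \<one>\<^bsub>L\<^esub> \<and> S \<otimes>\<^bsub>L\<^esub> x = \<one>\<^bsub>L\<^esub>"
    then have S_bl: "S \<in> bounded_linear_on_lqw q w"
      by (simp add: lqw_operators_def)
    show "S = T"
    proof (rule extensionalityI[of _ "lqw q w"])
      fix c assume c: "c \<in> lqw q w"
      then have Sc: "S c \<in> lqw q w"
        using S_bl by (auto simp: bounded_linear_on_lqw_def)
      have "(x \<otimes>\<^bsub>L\<^esub> S) c = \<one>\<^bsub>L\<^esub> c"
        using S by simp
      then have "mat_apply a (S c) = c"
        using c Sc by (simp add: lqw_operators_def x mat_operator_def)
      then show "S c = T c"
        using TA[OF Sc] by simp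
    qed (use S_bl T(1) in \<open>auto simp: bounded_linear_on_lqw_def PiE_def\<close>)
  qed
  ultimately show "inv\<^bsub>L\<^esub> x \<in> mat_operator q w ` B_matrices"
    using b by blast
qed

end

text \<open>The first conjunct says that the series in \<open>mat_apply\<close> converge, as
  \<open>infsum\<close> would otherwise default to 0; the second justifies identifying a matrix with
  its operator.\<close>

theorem theorem1p4:
  fixes q :: real and w :: "int ^ 'd::finite \<Rightarrow> real"
  assumes "1 \<le> q" and "discrete_Aq_weight q w"
  shows "(\<forall>a\<in>B_matrices. \<forall>c\<in>lqw q w. \<forall>i. (\<lambda>j. a i j * c j) summable_on UNIV) \<and>
    inj_on (mat_operator q w) B_matrices \<and>
    inverse_closed_subalgebra (mat_operator q w ` B_matrices) (lqw_operators q w)"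
proof -
  obtain C where "muckenhoupt q w C"
    using muckenhoupt_of_discrete_Aq[OF assms] .
  then interpret muckenhoupt q w C .
  show ?thesis
    using B_mat_summable inj_on_mat_operator inverse_closed_B by blast
qed

end
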